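(* Let $D$ be an almost Dedekind domain. Then $D$ is SP-scattered.
   Context: An almost Dedekind domain is an integral domain $D$ such that $D_M$ is a discrete valuation ring for every maximal ideal $M$ of $D$ (in particular $D$ is not a field). Let $K$ be the quotient field of $D$ and $\mathcal{M}$ the set of maximal ideals of $D$. A maximal ideal $M$ of an almost Dedekind domain $T$ is critical if $M$ does not contain any nonzero finitely generated radical ideal of $T$; $\mathrm{Crit}(T)$ is the set of critical maximal ideals of $T$. Define by transfinite recursion sets $\mathrm{Crit}_\alpha(D)\subseteq\mathcal{M}$ and overrings $T_\alpha$ of $D$ (rings between $D$ and $K$): - $\mathrm{Crit}_0(D):=\mathcal{M}$, $T_0:=D$; - if $\alpha=\gamma+1$, $\mathrm{Crit}_\alpha(D):=\{P\in\mathcal{M}\mid PT_\gamma\in\mathrm{Crit}(T_\gamma)\}$; - if $\alpha$ is a limit ordinal, $\mathrm{Crit}_\alpha(D):=\bigcap_{\gamma<\alpha}\mathrm{Crit}_\gamma(D)$; - $T_\alpha:=\bigcap\{D_P\mid P\in\mathrm{Crit}_\alpha(D)\}$. The maximal ideals of $T_\alpha$ are exactly the extensions $PT_\alpha$ of the $P\in\mathrm{Crit}_\alpha(D)$. Conventions: an empty intersection of overrings is $K$, and $\mathrm{Crit}(K)=\emptyset$ (so once some $\mathrm{Crit}_\gamma(D)$ is empty, all later ones are empty). The chain $\{\mathrm{Crit}_\alpha(D)\}_\alpha$ is descending and stabilizes; $\mathrm{Crit}_\infty(D)$ denotes its stable value (the intersection of all the $\mathrm{Crit}_\alpha(D)$).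 $D$ is SP-scattered if $\mathrm{Crit}_\infty(D)=\emptyset$, equivalently if $\mathrm{Crit}_\alpha(D)=\emptyset$ for some ordinal $\alpha$. *)

theory Defs
  imports "HOL-Algebra.Subrings" "HOL-Algebra.Ring_Divisibility"
begin

text \<open>
  A domain \<open>D\<close> is presented as a subring of its quotient field \<open>K\<close>. A ring \<open>T\<close> between \<open>D\<close> and
  \<open>K\<close> is a subset of \<open>carrier K\<close>, with ring structure \<open>K\<lparr>carrier := T\<rparr>\<close>.
\<close>

definition quotient_field_of :: "('a, 'b) ring_scheme \<Rightarrow> 'a set \<Rightarrow> bool" where
  "quotient_field_of K D \<longleftrightarrow> field K \<and> subring D K \<and>
     carrier K = {a \<otimes>\<^bsub>K\<^esub> inv\<^bsub>K\<^esub> b | a b. a \<in> D \<and> b \<in> D - {\<zero>\<^bsub>K\<^esub>}}"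

definition localization :: "('a, 'b) ring_scheme \<Rightarrow> 'a set \<Rightarrow> 'a set \<Rightarrow> 'a set" where
  "localization K D P = {a \<otimes>\<^bsub>K\<^esub> inv\<^bsub>K\<^esub> b | a b. a \<in> D \<and> b \<in> D - P}"

definition maximal_ideals :: "('a, 'b) ring_scheme \<Rightarrow> 'a set set" where
  "maximal_ideals R = {M. maximalideal M R}"

definition discrete_valuation_ring :: "('a, 'b) ring_scheme \<Rightarrow> bool" where
  "discrete_valuation_ring R \<longleftrightarrow> principal_domain R \<and> \<not> field R \<and> (\<exists>!M. maximalideal M R)"

definition almost_dedekind :: "('a, 'b) ring_scheme \<Rightarrow> 'a set \<Rightarrow> bool" where
  "almost_dedekind K D \<longleftrightarrow> domain (K\<lparr>carrier := D\<rparr>) \<and>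
     (\<forall>M \<in> maximal_ideals (K\<lparr>carrier := D\<rparr>).
        discrete_valuation_ring (K\<lparr>carrier := localization K D M\<rparr>))"

definition finitely_generated_ideal :: "('a, 'b) ring_scheme \<Rightarrow> 'a set \<Rightarrow> bool" where
  "finitely_generated_ideal R I \<longleftrightarrow> (\<exists>A. finite A \<and> A \<subseteq> carrier R \<and> I = Idl\<^bsub>R\<^esub> A)"

definition radical_ideal :: "('a, 'b) ring_scheme \<Rightarrow> 'a set \<Rightarrow> bool" where
  "radical_ideal R I \<longleftrightarrow> ideal I R \<and>
     (\<forall>x \<in> carrier R. \<forall>n::nat. x [^]\<^bsub>R\<^esub> n \<in> I \<longrightarrow> x \<in> I)"

text \<open>
  The case distinction is the convention that the critical set of a field is empty; without it
  the zero ideal of a field would be critical.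
\<close>

definition Crit :: "('a, 'b) ring_scheme \<Rightarrow> 'a set set" where
  "Crit R = (if field R then {} else
     {M \<in> maximal_ideals R.
        \<not> (\<exists>I. finitely_generated_ideal R I \<and> radical_ideal R I \<and> I \<noteq> {\<zero>\<^bsub>R\<^esub>} \<and> I \<subseteq> M)})"

text \<open>
  An ordinal is represented by an element \<open>\<alpha>\<close> of the field of a well-order \<open>r\<close>, standing for the
  order type of \<open>underS r \<alpha>\<close>. The relation below says \<open>\<alpha> = \<gamma> + 1\<close>.
\<close>

definition is_succ :: "'i rel \<Rightarrow> 'i \<Rightarrow> 'i \<Rightarrow> bool" where
  "is_succ r \<gamma> \<alpha> \<longleftrightarrow> \<gamma> \<in> underS r \<alpha> \<and> (\<forall>\<beta> \<in> underS r \<alpha>. (\<beta>, \<gamma>) \<in> r)"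

text \<open>
  The overring \<open>T\<^sub>\<alpha>\<close> determined by a family \<open>C\<close> of sets of maximal ideals of \<open>D\<close>. Intersecting with
  \<open>carrier K\<close> makes the empty intersection equal to \<open>K\<close>.
\<close>

definition overring_of ::
  "('a, 'b) ring_scheme \<Rightarrow> 'a set \<Rightarrow> 'i rel \<Rightarrow> ('i \<Rightarrow> 'a set set) \<Rightarrow> 'i \<Rightarrow> 'a set" where
  "overring_of K D r C \<alpha> =
     (if underS r \<alpha> = {} then D else carrier K \<inter> (\<Inter>P \<in> C \<alpha>. localization K D P))"

definition crit_step ::
  "('a, 'b) ring_scheme \<Rightarrow> 'a set \<Rightarrow> 'i rel \<Rightarrow> ('i \<Rightarrow> 'a set set) \<Rightarrow> 'i \<Rightarrow> 'a set set" where
  "crit_step K D r C \<alpha> =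
     (if underS r \<alpha> = {} then maximal_ideals (K\<lparr>carrier := D\<rparr>)
      else if \<exists>\<gamma>. is_succ r \<gamma> \<alpha> then
        (let T = K\<lparr>carrier := overring_of K D r C (THE \<gamma>. is_succ r \<gamma> \<alpha>)\<rparr>
         in {P \<in> maximal_ideals (K\<lparr>carrier := D\<rparr>). Idl\<^bsub>T\<^esub> P \<in> Crit T})
      else (\<Inter>\<gamma> \<in> underS r \<alpha>. C \<gamma>))"

definition Crit_stage ::
  "('a, 'b) ring_scheme \<Rightarrow> 'a set \<Rightarrow> 'i rel \<Rightarrow> 'i \<Rightarrow> 'a set set" where
  "Crit_stage K D r = wo_rel.worec r (crit_step K D r)"

definition T_stage ::
  "('a, 'b) ring_scheme \<Rightarrow> 'a set \<Rightarrow> 'i rel \<Rightarrow> 'i \<Rightarrow> 'a set" where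
  "T_stage K D r = overring_of K D r (Crit_stage K D r)"

text \<open>
  The intersection of all stages. Letting \<open>r\<close> run over the well-orders on \<open>'a set set\<close> makes \<open>\<alpha>\<close>
  run over all ordinals of cardinality at most that of \<open>'a set set\<close>. This loses nothing: each
  stage is a set of elements of type \<open>'a set\<close>, so the descending chain is constant from some
  ordinal of cardinality at most that of \<open>'a set\<close> on.
\<close>

definition Crit_infinity :: "('a, 'b) ring_scheme \<Rightarrow> 'a set \<Rightarrow> 'a set set" where
  "Crit_infinity K D =
     \<Inter> {Crit_stage K D r \<alpha> | (r :: 'a set set rel) \<alpha>. Well_order r \<and> \<alpha> \<in> Field r}"

definition SP_scattered :: "('a, 'b) ring_scheme \<Rightarrow> 'a set \<Rightarrow> bool" where
  "SP_scattered K D \<longleftrightarrow> Crit_infinity K D = {}"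

lemma is_succ_unique:
  assumes "Well_order r" "is_succ r \<gamma> \<alpha>" "is_succ r \<gamma>' \<alpha>"
  shows "\<gamma>' = \<gamma>"
  using assms wo_rel.ANTISYM[of r] unfolding is_succ_def wo_rel_def antisym_def by blast

lemma the_is_succ:
  assumes "Well_order r" "is_succ r \<gamma> \<alpha>"
  shows "(THE \<gamma>. is_succ r \<gamma> \<alpha>) = \<gamma>"
  using assms is_succ_unique by (metis the_equality)

lemma Crit_stage_unfold:
  assumes "Well_order r"
  shows "Crit_stage K D r \<alpha> = crit_step K D r (Crit_stage K D r) \<alpha>"
proof -
  interpret wo_rel r using assms by (simp add: wo_rel_def)
  have "crit_step K D r f \<alpha> = crit_step K D r g \<alpha>"
    if eq: "\<forall>\<beta> \<in> underS \<alpha>. f \<beta> = g \<beta>" for f g \<alpha>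
  proof (cases "\<exists>\<gamma>. is_succ r \<gamma> \<alpha>")
    case True
    then obtain \<gamma> where \<gamma>: "is_succ r \<gamma> \<alpha>" by blast
    then have "f \<gamma> = g \<gamma>" using eq by (simp add: is_succ_def)
    then have "overring_of K D r f \<gamma> = overring_of K D r g \<gamma>" by (simp add: overring_of_def)
    then show ?thesis using True by (simp add: crit_step_def the_is_succ[OF assms \<gamma>])
  next
    case False
    then show ?thesis using eq by (auto simp: crit_step_def)
  qed
  then have "adm_wo (crit_step K D r)" unfolding adm_wo_def by blast
  from worec_fixpoint[OF this] show ?thesis unfolding Crit_stage_def by metis
qed

lemma Crit_stage_zero:
  assumes "Well_order r" "underS r \<alpha> = {}"
  shows "Crit_stage K D r \<alpha> = maximal_ideals (K\<lparr>carrier := D\<rparr>)" and "T_stage K D r \<alpha> = D"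
  using assms by (simp_all add: Crit_stage_unfold crit_step_def T_stage_def overring_of_def)

lemma Crit_stage_succ:
  assumes "Well_order r" "is_succ r \<gamma> \<alpha>"
  shows "Crit_stage K D r \<alpha> = {P \<in> maximal_ideals (K\<lparr>carrier := D\<rparr>).
     Idl\<^bsub>K\<lparr>carrier := T_stage K D r \<gamma>\<rparr>\<^esub> P \<in> Crit (K\<lparr>carrier := T_stage K D r \<gamma>\<rparr>)}"
proof -
  have "underS r \<alpha> \<noteq> {}" using assms(2) by (auto simp: is_succ_def)
  then show ?thesis
    using assms by (subst Crit_stage_unfold) (auto simp: crit_step_def the_is_succ T_stage_def Let_def)
qed

lemma Crit_stage_limit:
  assumes "Well_order r" "underS r \<alpha> \<noteq> {}" "\<nexists>\<gamma>. is_succ r \<gamma> \<alpha>"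
  shows "Crit_stage K D r \<alpha> = (\<Inter>\<gamma> \<in> underS r \<alpha>. Crit_stage K D r \<gamma>)"
  using assms by (subst Crit_stage_unfold) (auto simp: crit_step_def)

lemma T_stage_pos:
  assumes "underS r \<alpha> \<noteq> {}"
  shows "T_stage K D r \<alpha> = carrier K \<inter> (\<Inter>P \<in> Crit_stage K D r \<alpha>. localization K D P)"
  using assms by (simp add: T_stage_def overring_of_def)

end

theory Submission
  imports Defs
begin

text \<open>
  The heart is that every domain whose localizations at maximal ideals are discrete valuation rings
  has a proper nonzero finitely generated radical ideal. Topologize the maximal ideals by the sets
  \<open>V(A) = {Q. A \<subseteq> Q}\<close> with \<open>A\<close> finite. The condition \<open>v\<^sub>Q(x) \<ge> n\<close> is open, and \<open>V(x)\<close> is the union of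
  the closed sets where \<open>v\<^sub>Q(x) \<le> n\<close>, so by Baire \<open>v\<^sub>Q(x)\<close> is bounded on some nonempty \<open>V(A)\<close>. Near
  a point of \<open>V(A)\<close> where it takes its maximum, a local uniformizer \<open>p\<close> of that point has valuation
  exactly 1, so adjoining \<open>p\<close> and finitely many elements to \<open>A\<close> generates a radical ideal.

  By transfinite induction every \<open>Crit\<^sub>\<alpha>(D)\<close> is closed in this topology. For a closed set the
  maximal ideals of the overring are exactly the extensions of its members, so the first statement
  applied to the overring shows that the chain decreases strictly as long as it is nonempty.
\<close>

section \<open>Maximal ideals of a commutative ring and membership tested locally\<close>

lemma (in cring) exists_maximalideal_above:
  assumes I: "ideal I R" "I \<noteq> carrier R"
  shows "\<exists>M. maximalideal M R \<and> I \<subseteq> M"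
proof -
  define S where "S = {J. ideal J R \<and> I \<subseteq> J \<and> \<one> \<notin> J}"
  have one: "\<one> \<notin> I" using I ideal.one_imp_carrier by blast
  have "\<exists>M\<in>S. \<forall>X\<in>S. M \<subseteq> X \<longrightarrow> X = M"
  proof (rule subset_Zorn_nonempty)
    show "S \<noteq> {}" using I one by (auto simp: S_def)
    fix C assume C: "C \<noteq> {}" "subset.chain S C"
    then have "subset.chain {J. ideal J R} C" by (auto simp: subset.chain_def S_def)
    from chain_Union_is_ideal[OF this] C(1) have "ideal (\<Union>C) R" by simp
    moreover have "J \<in> S" if "J \<in> C" for J using that C(2) by (auto simp: subset.chain_def)
    ultimately show "\<Union>C \<in> S" using C(1) unfolding S_def by blast
  qed
  then obtain M where M: "M \<in> S" "\<And>X. X \<in> S \<Longrightarrow> M \<subseteq> X \<Longrightarrow> X = M" by blast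
  have "maximalideal M R"
  proof (rule maximalidealI)
    show "ideal M R" "carrier R \<noteq> M" using M(1) by (auto simp: S_def)
    fix J assume J: "ideal J R" "M \<subseteq> J" "J \<subseteq> carrier R"
    show "J = M \<or> J = carrier R"
    proof (cases "\<one> \<in> J")
      case True then show ?thesis using ideal.one_imp_carrier J(1) by blast
    next
      case False then show ?thesis using M J by (auto simp: S_def)
    qed
  qed
  then show ?thesis using M(1) by (auto simp: S_def)
qed

lemma (in cring) maximalideal_comaximal:
  assumes M: "maximalideal M R" and s: "s \<in> carrier R - M"
  shows "\<exists>t\<in>M. \<exists>d\<in>carrier R. t \<oplus> s \<otimes> d = \<one>"
proof -
  interpret M: maximalideal M R by fact
  have s': "s \<in> carrier R" using s by blast
  have id: "ideal (M <+>\<^bsub>R\<^esub> PIdl s) R" by (rule add_ideals[OF M.is_ideal cgenideal_ideal[OF s']])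
  have sub: "M \<subseteq> M <+>\<^bsub>R\<^esub> PIdl s"
  proof
    fix m assume m: "m \<in> M"
    have "m \<oplus> \<zero> \<in> M <+>\<^bsub>R\<^esub> PIdl s"
      using m additive_subgroup.zero_closed[OF ideal.axioms(1)[OF cgenideal_ideal[OF s']]]
      unfolding set_add_def' by blast
    then show "m \<in> M <+>\<^bsub>R\<^esub> PIdl s" using m by simp
  qed
  have "\<zero> \<oplus> s \<in> M <+>\<^bsub>R\<^esub> PIdl s"
    using M.zero_closed cgenideal_self[OF s'] unfolding set_add_def' by blast
  then have "s \<in> M <+>\<^bsub>R\<^esub> PIdl s" using s' by simp
  then have "M <+>\<^bsub>R\<^esub> PIdl s = carrier R"
    using M.I_maximal[OF id sub] s ideal.Icarr[OF id] by blast
  then have "\<one> \<in> M <+>\<^bsub>R\<^esub> PIdl s" by simp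
  then obtain t d where "t \<in> M" "d \<in> carrier R" "\<one> = t \<oplus> d \<otimes> s"
    unfolding set_add_def' cgenideal_def by auto
  then show ?thesis using s' m_comm by metis
qed

lemma maximalideal_one_notin:
  assumes "maximalideal M R" shows "\<one>\<^bsub>R\<^esub> \<notin> M"
  using assms maximalideal.I_notcarr ideal.one_imp_carrier maximalideal.axioms(1) by metis

lemma (in cring) ideal_if_closed:
  assumes J: "J \<subseteq> carrier R" "\<zero> \<in> J"
    and add: "\<And>a b. a \<in> J \<Longrightarrow> b \<in> J \<Longrightarrow> a \<oplus> b \<in> J"
    and mult: "\<And>a x. a \<in> J \<Longrightarrow> x \<in> carrier R \<Longrightarrow> x \<otimes> a \<in> J"
  shows "ideal J R"
proof (rule idealI[OF ring_axioms])
  show "subgroup J (add_monoid R)"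
  proof (rule add.subgroupI)
    fix a assume a: "a \<in> J"
    have "\<ominus> a = (\<ominus> \<one>) \<otimes> a" using a J by (simp add: l_minus subsetD)
    then show "\<ominus> a \<in> J" using mult[OF a] by simp
  qed (use J add in auto)
  fix a x assume ax: "a \<in> J" "x \<in> carrier R"
  then show "x \<otimes> a \<in> J" by (rule mult)
  then show "a \<otimes> x \<in> J" using ax J m_comm by (metis subsetD)
qed

text \<open>The multipliers carrying \<open>z\<close> into \<open>I\<close> form an ideal that lies
  in no maximal ideal, so \<open>\<one>\<close> is among them. An ideal is shown to be radical this
  way below.\<close>

lemma (in cring) mem_ideal_if_locally_mem:
  assumes I: "ideal I R" and z: "z \<in> carrier R"
    and loc: "\<And>M. maximalideal M R \<Longrightarrow> \<exists>s\<in>carrier R - M. s \<otimes> z \<in> I"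
  shows "z \<in> I"
proof -
  interpret I: ideal I R by fact
  define J where "J = {d \<in> carrier R. d \<otimes> z \<in> I}"
  have J: "ideal J R"
    by (rule ideal_if_closed) (use z in \<open>auto simp: J_def l_distr m_assoc I.I_l_closed\<close>)
  have "J = carrier R"
  proof (rule ccontr)
    assume "J \<noteq> carrier R"
    then obtain M where "maximalideal M R" "J \<subseteq> M" using exists_maximalideal_above[OF J] by blast
    then show False using loc[of M] by (auto simp: J_def)
  qed
  then have "\<one> \<in> J" by simp
  then show ?thesis using z by (simp add: J_def)
qed

section \<open>Valuations at a maximal ideal, expressed without localizing\<close>

text \<open>In the localization at \<open>M\<close> this reads \<open>x = (u / s) p^n\<close> with a
  unit \<open>u / s\<close>, so \<open>n\<close> is the valuation of \<open>x\<close>. Clearing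
  denominators keeps everything inside \<open>R\<close>.\<close>

definition uniformizer :: "('a, 'b) ring_scheme \<Rightarrow> 'a set \<Rightarrow> 'a \<Rightarrow> bool" where
  "uniformizer R M p \<longleftrightarrow> p \<in> M \<and> p \<noteq> \<zero>\<^bsub>R\<^esub> \<and>
     (\<forall>x\<in>carrier R - {\<zero>\<^bsub>R\<^esub>}. \<exists>(n::nat) s u. s \<in> carrier R - M \<and> u \<in> carrier R - M \<and>
        s \<otimes>\<^bsub>R\<^esub> x = u \<otimes>\<^bsub>R\<^esub> p [^]\<^bsub>R\<^esub> n)"

text \<open>When a uniformizer exists, this says that the valuation of \<open>x\<close> at
  \<open>M\<close> is at least \<open>n\<close>. The base \<open>y\<close> may be any element of
  \<open>M\<close>, so the same \<open>y\<close>, \<open>s\<close>, \<open>a\<close> serve at every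
  maximal ideal that contains \<open>y\<close> and avoids \<open>s\<close>.\<close>

definition val_ge :: "('a, 'b) ring_scheme \<Rightarrow> 'a set \<Rightarrow> 'a \<Rightarrow> nat \<Rightarrow> bool" where
  "val_ge R M x n \<longleftrightarrow> (\<exists>y\<in>M. \<exists>s\<in>carrier R - M. \<exists>a\<in>carrier R.
     s \<otimes>\<^bsub>R\<^esub> x = a \<otimes>\<^bsub>R\<^esub> y [^]\<^bsub>R\<^esub> n)"

context domain
begin

lemma maximalideal_mult_notin:
  assumes "maximalideal M R" "a \<in> carrier R - M" "b \<in> carrier R - M"
  shows "a \<otimes> b \<in> carrier R - M"
  using primeideal.I_prime[OF maximalideal_prime[OF assms(1)]] assms(2,3) by blast

lemma maximalideal_pow_notin:
  assumes "maximalideal M R" "a \<in> carrier R - M"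
  shows "a [^] (n::nat) \<in> carrier R - M"
proof (induction n)
  case 0 then show ?case using maximalideal_one_notin[OF assms(1)] by simp
next
  case (Suc n) then show ?case using maximalideal_mult_notin[OF assms(1) Suc assms(2)] by simp
qed

lemma maximalideal_carrier: "maximalideal M R \<Longrightarrow> a \<in> M \<Longrightarrow> a \<in> carrier R"
  using ideal.Icarr maximalideal.axioms(1) by metis

lemma nat_pow_nonzero: "a \<in> carrier R \<Longrightarrow> a \<noteq> \<zero> \<Longrightarrow> a [^] (n::nat) \<noteq> \<zero>"
  by (induction n) (auto simp: integral_iff)

text \<open>The exponent of a nonzero \<open>y\<close> is positive, since exponent zero would give
  \<open>s \<otimes> y = u\<close> with the left side in \<open>M\<close> and the right side
  outside. So one factor \<open>p\<close> splits off.\<close>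

lemma uniformizer_mem:
  assumes M: "maximalideal M R" and p: "uniformizer R M p" and y: "y \<in> M"
  shows "\<exists>s\<in>carrier R - M. \<exists>c\<in>carrier R. s \<otimes> y = c \<otimes> p"
proof (cases "y = \<zero>")
  case True
  then show ?thesis using maximalideal_one_notin[OF M] p maximalideal_carrier[OF M]
    by (auto simp: uniformizer_def intro!: bexI[of _ \<one>] bexI[of _ \<zero>])
next
  case False
  interpret M: maximalideal M R by fact
  have pc: "p \<in> carrier R" using p maximalideal_carrier[OF M] by (auto simp: uniformizer_def)
  from False y p maximalideal_carrier[OF M] obtain n :: nat and s u
    where n: "s \<in> carrier R - M" "u \<in> carrier R - M" "s \<otimes> y = u \<otimes> p [^] n"
    unfolding uniformizer_def by blast
  show ?thesis
  proof (cases n)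
    case 0
    then show ?thesis using n y M.I_l_closed[of y s] by auto
  next
    case (Suc k)
    then have "s \<otimes> y = (u \<otimes> p [^] k) \<otimes> p" using n pc by (simp add: m_assoc)
    then show ?thesis using n pc by blast
  qed
qed

text \<open>An exponent occurring in a factorization is the exact valuation. If
  \<open>m < n\<close>, rewriting \<open>y\<close> as a local multiple of \<open>p\<close> and
  cancelling \<open>p^m\<close> puts a product of elements outside \<open>M\<close> into
  \<open>M\<close>.\<close>

lemma val_ge_le:
  assumes M: "maximalideal M R" and p: "uniformizer R M p"
    and x: "x \<in> carrier R" "x \<noteq> \<zero>" and ge: "val_ge R M x n"
    and eq: "s \<in> carrier R - M" "u \<in> carrier R - M" "s \<otimes> x = u \<otimes> p [^] (m::nat)"
  shows "n \<le> m"
proof (rule ccontr)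
  assume "\<not> n \<le> m"
  then obtain k where k: "n = Suc k + m" using less_iff_Suc_add[of m n] by (auto simp: add_ac)
  interpret M: maximalideal M R by fact
  have pc: "p \<in> carrier R" "p \<in> M" "p \<noteq> \<zero>"
    using p maximalideal_carrier[OF M] by (auto simp: uniformizer_def)
  obtain y r a where y: "y \<in> M" "r \<in> carrier R - M" "a \<in> carrier R" "r \<otimes> x = a \<otimes> y [^] n"
    using ge by (auto simp: val_ge_def)
  obtain t c where t: "t \<in> carrier R - M" "c \<in> carrier R" "t \<otimes> y = c \<otimes> p"
    using uniformizer_mem[OF M p y(1)] by blast
  have yc: "y \<in> carrier R" using y by auto
  have c: "s \<in> carrier R" "u \<in> carrier R" "r \<in> carrier R" "t \<in> carrier R" using eq y t by auto
  have "(t [^] n \<otimes> r \<otimes> u) \<otimes> p [^] m = t [^] n \<otimes> r \<otimes> (s \<otimes> x)"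
    using c pc by (simp add: eq m_assoc)
  also have "\<dots> = t [^] n \<otimes> s \<otimes> (r \<otimes> x)" using c x by (simp add: m_ac)
  also have "\<dots> = s \<otimes> a \<otimes> (t \<otimes> y) [^] n" using c x y yc by (simp add: m_ac pow_mult_distrib)
  also have "\<dots> = s \<otimes> a \<otimes> (c [^] n \<otimes> (p [^] k \<otimes> p \<otimes> p [^] m))"
  proof -
    have "(c \<otimes> p) [^] n = c [^] n \<otimes> p [^] n" using t pc by (simp add: pow_mult_distrib m_comm)
    moreover have "p [^] n = p [^] k \<otimes> p \<otimes> p [^] m"
      using pc nat_pow_mult[of p "Suc k" m] by (simp add: k)
    ultimately show ?thesis by (simp add: t)
  qed
  also have "\<dots> = (s \<otimes> a \<otimes> c [^] n \<otimes> p [^] k \<otimes> p) \<otimes> p [^] m"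
    using c y pc t by (simp add: m_assoc)
  finally have "t [^] n \<otimes> r \<otimes> u = s \<otimes> a \<otimes> c [^] n \<otimes> p [^] k \<otimes> p"
    using c y pc t m_rcancel[OF nat_pow_nonzero] by simp
  moreover have "s \<otimes> a \<otimes> c [^] n \<otimes> p [^] k \<otimes> p \<in> M" using c y pc t by (simp add: M.I_l_closed)
  moreover have "t [^] n \<otimes> r \<otimes> u \<in> carrier R - M"
    by (intro maximalideal_mult_notin[OF M] maximalideal_pow_notin[OF M] t y eq)
  ultimately show False by simp
qed

text \<open>Since \<open>M\<close> is maximal, the basic open set \<open>s \<notin> M\<close> contains the closed neighbourhood
  \<open>{Q. t \<in> Q}\<close> of \<open>M\<close> for some \<open>t\<close>; hence \<open>v\<^sub>Q(x) \<ge> n\<close> is an open condition on \<open>Q\<close> for the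
  topology whose basic open sets are the \<open>{Q. B \<subseteq> Q}\<close> with \<open>B\<close> finite.\<close>

lemma maximalideal_separating_element:
  assumes M: "maximalideal M R" and s: "s \<in> carrier R - M"
  obtains t where "t \<in> M" "\<And>Q. maximalideal Q R \<Longrightarrow> t \<in> Q \<Longrightarrow> s \<notin> Q"
proof -
  obtain t d where t: "t \<in> M" "d \<in> carrier R" "t \<oplus> s \<otimes> d = \<one>"
    using maximalideal_comaximal[OF M s] by blast
  have "s \<notin> Q" if Q: "maximalideal Q R" "t \<in> Q" for Q
  proof
    interpret Q: maximalideal Q R by fact
    assume "s \<in> Q"
    then have "t \<oplus> s \<otimes> d \<in> Q" using Q(2) t(2) by (intro Q.a_closed Q.I_r_closed)
    then show False using t maximalideal_one_notin[OF Q(1)] by simp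
  qed
  with t that show ?thesis by blast
qed

lemma val_ge_one: "maximalideal M R \<Longrightarrow> x \<in> M \<Longrightarrow> val_ge R M x 1"
  using maximalideal_one_notin maximalideal_carrier unfolding val_ge_def
  by (intro bexI[of _ x] bexI[of _ \<one>]) auto

lemma proper_if_subset_maximalideal:
  assumes "maximalideal M R" "A \<subseteq> M"
  shows "\<one> \<notin> Idl A"
  using genideal_minimal[OF maximalideal.axioms(1)[OF assms(1)] assms(2)] maximalideal_one_notin[OF assms(1)]
  by blast

lemma obtain_maximalideal_above:
  assumes "A \<subseteq> carrier R" "\<one> \<notin> Idl A"
  obtains M where "maximalideal M R" "A \<subseteq> M"
  using exists_maximalideal_above[OF genideal_ideal[OF assms(1)]] assms genideal_self[OF assms(1)] by blast

text \<open>The density half of the Baire argument; \<open>\<one> \<notin> Idl B\<close> says that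
  the open set given by \<open>B\<close> is nonempty. Either the valuation reaches \<open>n\<close>
  at some point over \<open>A\<close>, and openness gives a neighbourhood, or it has a maximum over
  \<open>A\<close>, and near a maximum point a radical ideal arises that \<open>no_radical\<close>
  excludes.\<close>

lemma val_ge_on_neighbourhood:
  assumes unif: "\<And>M. maximalideal M R \<Longrightarrow> \<exists>p. uniformizer R M p"
    and no_radical: "\<And>I. finitely_generated_ideal R I \<Longrightarrow> radical_ideal R I \<Longrightarrow> I \<noteq> {\<zero>} \<Longrightarrow> \<one> \<in> I"
    and x: "x \<noteq> \<zero>" "x \<in> A"
    and A: "finite A" "A \<subseteq> carrier R" "\<one> \<notin> Idl A"
  shows "\<exists>B. finite B \<and> B \<subseteq> carrier R \<and> A \<subseteq> B \<and> \<one> \<notin> Idl B \<and>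
    (\<forall>M. maximalideal M R \<longrightarrow> B \<subseteq> M \<longrightarrow> val_ge R M x n)"
proof (cases "\<exists>M. maximalideal M R \<and> A \<subseteq> M \<and> val_ge R M x n")
  case True
  then obtain M where M: "maximalideal M R" "A \<subseteq> M" "val_ge R M x n" by blast
  then obtain y s a where y: "y \<in> M" "s \<in> carrier R - M" "a \<in> carrier R" "s \<otimes> x = a \<otimes> y [^] n"
    by (auto simp: val_ge_def)
  obtain t where t: "t \<in> M" "\<And>Q. maximalideal Q R \<Longrightarrow> t \<in> Q \<Longrightarrow> s \<notin> Q"
    using maximalideal_separating_element[OF M(1) y(2)] by blast
  \<comment> \<open>Over \<open>?B\<close> the element \<open>y\<close> stays in the ideal and
    \<open>t\<close> keeps \<open>s\<close> out of it, so the identity for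
    \<open>s \<otimes> x\<close> remains a witness.\<close>
  let ?B = "insert t (insert y A)"
  have "?B \<subseteq> M" using t y M by auto
  then have "\<one> \<notin> Idl ?B" "?B \<subseteq> carrier R"
    using proper_if_subset_maximalideal[OF M(1)] maximalideal_carrier[OF M(1)] by blast+
  moreover have "val_ge R Q x n" if "maximalideal Q R" "?B \<subseteq> Q" for Q
    unfolding val_ge_def using that t y by blast
  ultimately show ?thesis using A by (intro exI[of _ ?B]) auto
next
  case False
  define E where "E m \<longleftrightarrow> (\<exists>M. maximalideal M R \<and> A \<subseteq> M \<and> val_ge R M x m)" for m
  have xc: "x \<in> carrier R" using x A by blast
  have mono: "E m" if "E k" "m \<le> k" for m k
  proof -
    obtain M where M: "maximalideal M R" "A \<subseteq> M" "val_ge R M x k" using \<open>E k\<close> by (auto simp: E_def)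
    then obtain y s a where y: "y \<in> M" "s \<in> carrier R - M" "a \<in> carrier R" "s \<otimes> x = a \<otimes> y [^] k"
      by (auto simp: val_ge_def)
    have "y \<in> carrier R" using y M maximalideal_carrier by blast
    then have "s \<otimes> x = (a \<otimes> y [^] (k - m)) \<otimes> y [^] m"
      using y that by (simp add: m_assoc nat_pow_mult)
    then have "val_ge R M x m" unfolding val_ge_def using y \<open>y \<in> carrier R\<close> by blast
    then show ?thesis using M by (auto simp: E_def)
  qed
  have bound: "m \<le> n" if "E m" for m
    using False mono[OF that, of n] E_def by (meson nat_le_linear)
  obtain M0 where "maximalideal M0 R" "A \<subseteq> M0" using obtain_maximalideal_above[OF A(2,3)] by blast
  then have E1: "E 1" using val_ge_one[of M0 x] x by (auto simp: E_def)
  \<comment> \<open>The maximal valuation of \<open>x\<close> over \<open>A\<close>: bounded by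
    \<open>n\<close> since the case assumption denies \<open>E n\<close>, and at least 1 since
    \<open>x\<close> belongs to \<open>A\<close>.\<close>
  define m where "m = (GREATEST m. E m)"
  have Em: "E m" unfolding m_def by (rule GreatestI_nat[of E 1 n]) (use E1 bound in auto)
  have max: "k \<le> m" if "E k" for k
    unfolding m_def by (rule Greatest_le_nat[of E k n]) (use that bound in auto)
  have m1: "m \<ge> 1" using max[OF E1] .
  obtain M where M: "maximalideal M R" "A \<subseteq> M" "val_ge R M x m" using Em by (auto simp: E_def)
  obtain p where p: "uniformizer R M p" using unif[OF M(1)] by blast
  have pM: "p \<in> M" "p \<in> carrier R" using p maximalideal_carrier[OF M(1)] by (auto simp: uniformizer_def)
  obtain m' :: nat and s u where s: "s \<in> carrier R - M" "u \<in> carrier R - M" "s \<otimes> x = u \<otimes> p [^] m'"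
    using p x xc unfolding uniformizer_def by blast
  have "m \<le> m'" by (rule val_ge_le[OF M(1) p xc x(1) M(3) s])
  moreover have "val_ge R M x m'" unfolding val_ge_def using s pM by blast
  then have "m' \<le> m" using max M by (auto simp: E_def)
  ultimately have m': "m' = m" by simp
  obtain t where t: "t \<in> M" "\<And>Q. maximalideal Q R \<Longrightarrow> t \<in> Q \<Longrightarrow> s \<notin> Q"
    using maximalideal_separating_element[OF M(1) s(1)] by blast
  \<comment> \<open>Adding \<open>t\<close> keeps \<open>s\<close> outside every maximal ideal over
    \<open>B\<close>, so \<open>s \<otimes> x = u \<otimes> p [^] m\<close> bounds the valuation of
    \<open>x\<close> from below there. The element \<open>u\<close> may enter such an ideal; only
    the lower bound is used.\<close>
  define B where "B = insert t (insert p A)"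
  have B: "finite B" "B \<subseteq> M" "B \<subseteq> carrier R"
    using A t(1) pM M maximalideal_carrier[OF M(1)] unfolding B_def by auto
  have BI: "B \<subseteq> Idl B" using genideal_self[OF B(3)] .
  interpret I: ideal "Idl B" R using genideal_ideal[OF B(3)] .
  \<comment> \<open>By maximality of \<open>m\<close>, the element \<open>p\<close> has valuation exactly 1 on the whole neighbourhood.\<close>
  have key: "\<exists>d\<in>carrier R - Q. d \<otimes> z \<in> Idl B" if Q: "maximalideal Q R" "B \<subseteq> Q" and z: "z \<in> Q" for Q z
  proof -
    obtain q where q: "uniformizer R Q q" using unif[OF Q(1)] by blast
    have qQ: "q \<in> Q" "q \<in> carrier R" using q maximalideal_carrier[OF Q(1)] by (auto simp: uniformizer_def)
    have zc: "z \<in> carrier R" using z maximalideal_carrier[OF Q(1)] by blast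
    interpret Q: maximalideal Q R by fact
    have pQ: "p \<in> Q" using Q(2) by (simp add: B_def)
    have sQ: "s \<in> carrier R - Q" using t(2)[OF Q(1)] Q(2) s by (auto simp: B_def)
    have "p \<in> carrier R - {\<zero>}" using p pM by (auto simp: uniformizer_def)
    then obtain k :: nat and s' c where c: "s' \<in> carrier R - Q" "c \<in> carrier R - Q" "s' \<otimes> p = c \<otimes> q [^] k"
      using q unfolding uniformizer_def by meson
    have cc: "s' \<in> carrier R" "c \<in> carrier R" "s \<in> carrier R" "u \<in> carrier R" using c s by auto
    \<comment> \<open>If \<open>p\<close> has valuation \<open>k\<close> at \<open>Q\<close>, then
      \<open>x\<close> has valuation at least \<open>k * m\<close> there, and this cannot exceed the
      maximum \<open>m\<close>.\<close>
    have "s' [^] m \<otimes> s \<otimes> x = s' [^] m \<otimes> (u \<otimes> p [^] m)" using cc xc s m' by (simp add: m_assoc)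
    also have "\<dots> = u \<otimes> (s' \<otimes> p) [^] m" using cc pM by (simp add: pow_mult_distrib m_comm m_lcomm)
    also have "\<dots> = (u \<otimes> c [^] m) \<otimes> q [^] (k * m)"
    proof -
      have "(c \<otimes> q [^] k) [^] m = c [^] m \<otimes> q [^] (k * m)"
        using cc qQ by (simp add: pow_mult_distrib m_comm nat_pow_pow)
      then show ?thesis using cc qQ by (simp add: c m_assoc)
    qed
    finally have "val_ge R Q x (k * m)" unfolding val_ge_def
      using qQ cc maximalideal_mult_notin[OF Q(1) maximalideal_pow_notin[OF Q(1) c(1)] sQ] by blast
    moreover have "A \<subseteq> Q" using Q(2) by (auto simp: B_def)
    ultimately have "k * m \<le> m" using Q(1) by (intro max) (auto simp: E_def)
    then have "k \<le> 1" using m1 by auto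
    moreover have "k \<noteq> 0"
    proof
      assume "k = 0"
      then have "c \<in> Q" using c(3) cc Q.I_l_closed[OF pQ cc(1)] by simp
      then show False using c(2) by blast
    qed
    ultimately have "k = 1" by simp
    then have sp: "s' \<otimes> p = c \<otimes> q" using c qQ by simp
    obtain d e where d: "d \<in> carrier R - Q" "e \<in> carrier R" "d \<otimes> z = e \<otimes> q"
      using uniformizer_mem[OF Q(1) q z] by blast
    \<comment> \<open>Locally at \<open>Q\<close>, \<open>z\<close> is a multiple of
      \<open>q\<close> and \<open>q\<close> is a multiple of \<open>p\<close>, which lies in
      \<open>B\<close>.\<close>
    have "(c \<otimes> d) \<otimes> z = e \<otimes> (c \<otimes> q)" using d cc zc qQ by (simp add: m_assoc m_lcomm)
    also have "\<dots> = (e \<otimes> s') \<otimes> p" using d cc pM by (simp add: sp[symmetric] m_assoc)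
    also have "\<dots> \<in> Idl B" using BI d cc by (intro I.I_l_closed) (auto simp: B_def)
    finally show ?thesis using maximalideal_mult_notin[OF Q(1) c(2) d(1)] by blast
  qed
  have one: "\<one> \<notin> Idl B" by (rule proper_if_subset_maximalideal[OF M(1) B(2)])
  have "radical_ideal R (Idl B)"
    unfolding radical_ideal_def
  proof (intro conjI ballI allI impI)
    show "ideal (Idl B) R" by (rule I.is_ideal)
    fix z and j :: nat assume z: "z \<in> carrier R" "z [^] j \<in> Idl B"
    show "z \<in> Idl B"
    \<comment> \<open>If \<open>B \<subseteq> Q\<close>, a power of \<open>z\<close> in
      \<open>Q\<close> forces \<open>z\<close> into \<open>Q\<close>, and \<open>key\<close>
      applies. Otherwise an element of \<open>B\<close> outside \<open>Q\<close> is itself a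
      multiplier.\<close>
    proof (rule mem_ideal_if_locally_mem[OF I.is_ideal z(1)])
      fix Q assume Q: "maximalideal Q R"
      show "\<exists>d\<in>carrier R - Q. d \<otimes> z \<in> Idl B"
      proof (cases "B \<subseteq> Q")
        case True
        then have "Idl B \<subseteq> Q" using genideal_minimal maximalideal.axioms(1)[OF Q] by blast
        then have "z \<in> Q" using z maximalideal_pow_notin[OF Q, of z j] by blast
        then show ?thesis using key[OF Q True] by blast
      next
        case False
        then obtain b where b: "b \<in> B" "b \<notin> Q" by blast
        then have "b \<otimes> z \<in> Idl B" using BI z by (intro I.I_r_closed) auto
        then show ?thesis using b B by blast
      qed
    qed
  qed
  moreover have "finitely_generated_ideal R (Idl B)" unfolding finitely_generated_ideal_def using B by blast
  moreover have "Idl B \<noteq> {\<zero>}" using BI x by (auto simp: B_def)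
  ultimately show ?thesis using no_radical one by blast
qed

text \<open>A Baire category argument: if no proper nonzero finitely generated ideal were radical, then
  every basic open set would contain smaller ones on which the valuations of a fixed \<open>x\<close> are
  arbitrarily large, and by compactness some maximal ideal would give \<open>x\<close> infinite valuation.\<close>

theorem exists_finitely_generated_radical_ideal:
  assumes unif: "\<And>M. maximalideal M R \<Longrightarrow> \<exists>p. uniformizer R M p"
  shows "\<exists>I. finitely_generated_ideal R I \<and> radical_ideal R I \<and> I \<noteq> {\<zero>} \<and> \<one> \<notin> I"
proof (rule ccontr)
  assume "\<not> ?thesis"
  then have no_radical: "\<And>I. finitely_generated_ideal R I \<Longrightarrow> radical_ideal R I \<Longrightarrow> I \<noteq> {\<zero>} \<Longrightarrow> \<one> \<in> I"
    by blast
  have "{\<zero>} \<noteq> carrier R" using one_not_zero one_closed by blast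
  then obtain M where M: "maximalideal M R" using exists_maximalideal_above[OF zeroideal] by blast
  obtain x where x: "x \<in> M" "x \<noteq> \<zero>" using unif[OF M] by (auto simp: uniformizer_def)
  have xc: "x \<in> carrier R" using x maximalideal_carrier[OF M] by blast
  \<comment> \<open>The guard \<open>n > 0\<close> leaves, at the start of the sequence, only
    conditions that \<open>{x}\<close> satisfies.\<close>
  define P where "P n A \<longleftrightarrow> finite A \<and> A \<subseteq> carrier R \<and> x \<in> A \<and> \<one> \<notin> Idl A \<and>
    (n > 0 \<longrightarrow> (\<forall>M. maximalideal M R \<longrightarrow> A \<subseteq> M \<longrightarrow> val_ge R M x n))" for n :: nat and A
  have "\<exists>f. \<forall>n. P n (f n) \<and> f n \<subseteq> f (Suc n)"
  proof (rule dependent_nat_choice)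
    show "\<exists>A. P 0 A"
      using xc proper_if_subset_maximalideal[OF M, of "{x}"] x by (auto simp: P_def intro!: exI[of _ "{x}"])
    fix A n assume "P n A"
    then show "\<exists>B. P (Suc n) B \<and> A \<subseteq> B"
      using val_ge_on_neighbourhood[OF unif no_radical x(2), of A "Suc n"] unfolding P_def by blast
  qed
  then obtain f where f: "\<And>n. P n (f n)" "\<And>n. f n \<subseteq> f (Suc n)" by blast
  have fc: "f n \<subseteq> carrier R" "\<one> \<notin> Idl (f n)" for n using f(1)[of n] by (auto simp: P_def)
  have mono: "f m \<subseteq> f n" if "m \<le> n" for m n using that f(2) by (simp add: lift_Suc_mono_le)
  \<comment> \<open>Compactness: an increasing union of proper ideals is proper, so a maximal ideal
    above \<open>J\<close> lies in all the nested open sets at once.\<close>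
  define J where "J = \<Union>(range (\<lambda>n. Idl (f n)))"
  have "subset.chain {I. ideal I R} (range (\<lambda>n. Idl (f n)))"
  proof -
    have "Idl (f m) \<subseteq> Idl (f n)" if "m \<le> n" for m n
      using subset_Idl_subset[OF fc(1) mono[OF that]] .
    then have "Idl (f m) \<subseteq> Idl (f n) \<or> Idl (f n) \<subseteq> Idl (f m)" for m n
      by (meson nat_le_linear)
    then show ?thesis using genideal_ideal[OF fc(1)]
      unfolding subset_chain_def by blast
  qed
  then have "ideal J R" using chain_Union_is_ideal unfolding J_def by fastforce
  moreover have "\<one> \<notin> J" using fc by (auto simp: J_def)
  ultimately obtain N where N: "maximalideal N R" "J \<subseteq> N"
    using exists_maximalideal_above[of J] one_closed by blast
  have fN: "f n \<subseteq> N" for n using genideal_self[OF fc(1), of n] N(2) unfolding J_def by blast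
  obtain q where q: "uniformizer R N q" using unif[OF N(1)] by blast
  then obtain m :: nat and s u where s: "s \<in> carrier R - N" "u \<in> carrier R - N" "s \<otimes> x = u \<otimes> q [^] m"
    using x xc unfolding uniformizer_def by blast
  have "val_ge R N x (Suc m)" using f(1)[of "Suc m"] N(1) fN by (auto simp: P_def)
  from val_ge_le[OF N(1) q xc x(2) this s] show False by simp
qed

end

section \<open>Factorization in a discrete valuation ring\<close>

text \<open>Every irreducible generates a maximal ideal, hence the only one, and so is a unit
  multiple of its generator \<open>p\<close>. Factoring into irreducibles leaves a unit times a
  power of \<open>p\<close>, and \<open>p\<close> is nonzero because the ring is not a
  field.\<close>

lemma (in principal_domain) unique_maximalideal_factorization:
  assumes "\<not> field R" and uniq: "\<exists>!M. maximalideal M R"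
  shows "\<exists>p\<in>carrier R. p \<noteq> \<zero> \<and> p \<notin> Units R \<and>
    (\<forall>x\<in>carrier R - {\<zero>}. \<exists>(n::nat). \<exists>u\<in>Units R. x = u \<otimes> p [^] n)"
proof -
  obtain M where M: "maximalideal M R" "\<And>N. maximalideal N R \<Longrightarrow> N = M" using uniq by blast
  interpret M: maximalideal M R by (rule M(1))
  obtain p where p: "p \<in> carrier R" "M = PIdl p" using exists_gen[OF M.is_ideal] by blast
  have "p \<noteq> \<zero>"
  proof
    assume "p = \<zero>"
    then have "M = {\<zero>}" using p cgenideal_eq_genideal genideal_zero by simp
    then show False using zeromaximalideal_fieldI M(1) assms(1) by blast
  qed
  moreover have "p \<notin> Units R" using ideal_eq_carrier_iff[OF p(1)] p(2) M.I_notcarr by blast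
  moreover have "\<exists>(n::nat). \<exists>u\<in>Units R. x = u \<otimes> p [^] n" if x: "x \<in> carrier R - {\<zero>}" for x
  proof -
    obtain fs where fs: "set fs \<subseteq> carrier (mult_of R)" "wfactors (mult_of R) fs x"
      using mult_of.wfactors_exist[of x] x by auto
    have irr: "\<exists>u\<in>Units R. q = u \<otimes> p" if q: "q \<in> carrier R - {\<zero>}" "irreducible (mult_of R) q" for q
    proof -
      have "ring_irreducible q" using q ring_irreducibleI' by blast
      then have "PIdl q = PIdl p" using irreducible_imp_maximalideal M(2) q p(2) by blast
      then have "q \<sim> p" using associated_iff_same_ideal q p by blast
      then show ?thesis using ring_associated_iff q p by blast
    qed
    have powers: "\<exists>n::nat. \<exists>u\<in>Units R. foldr (\<otimes>) gs \<one> = u \<otimes> p [^] n"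
      if "set gs \<subseteq> carrier R - {\<zero>}" "\<forall>g\<in>set gs. irreducible (mult_of R) g" for gs
      using that
    proof (induction gs)
      case Nil
      then show ?case by (intro exI[of _ "0::nat"] bexI[of _ \<one>]) auto
    next
      case (Cons g gs)
      then obtain n :: nat and u where u: "u \<in> Units R" "foldr (\<otimes>) gs \<one> = u \<otimes> p [^] n" by auto
      obtain v where v: "v \<in> Units R" "g = v \<otimes> p" using irr[of g] Cons.prems by auto
      have "foldr (\<otimes>) (g # gs) \<one> = (v \<otimes> u) \<otimes> p [^] Suc n"
        using u v p by (simp add: m_ac Units_closed)
      then show ?case using u(1) v(1) by blast
    qed
    have "set fs \<subseteq> carrier R - {\<zero>}" "\<forall>g\<in>set fs. irreducible (mult_of R) g"
      using fs by (auto simp: wfactors_def)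
    from powers[OF this] obtain n :: nat and u
      where u: "u \<in> Units R" "foldr (\<otimes>) fs \<one> = u \<otimes> p [^] n" by blast
    have "x \<sim>\<^bsub>mult_of R\<^esub> (u \<otimes> p [^] n)"
      using fs(2) u by (auto simp: wfactors_def intro: mult_of.associated_sym)
    then have "x \<sim> (u \<otimes> p [^] n)"
      using assoc_iff_assoc_mult[of x "u \<otimes> p [^] n"] x u p by (simp add: Units_closed)
    then obtain v where "v \<in> Units R" "x = v \<otimes> (u \<otimes> p [^] n)"
      using ring_associated_iff[of x] x u p by (auto simp: Units_closed)
    then have "x = (v \<otimes> u) \<otimes> p [^] n" "v \<otimes> u \<in> Units R" using u p by (auto simp: m_assoc Units_closed)
    then show ?thesis by blast
  qed
  ultimately show ?thesis using p by blast
qed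

section \<open>A domain inside its quotient field, and its localizations\<close>

locale fraction_field = field K for K (structure) +
  fixes D :: "'a set"
  assumes subring_D: "subring D K"
    and fractions: "\<And>z. z \<in> carrier K \<Longrightarrow> \<exists>b\<in>D - {\<zero>}. z \<otimes> b \<in> D"
begin

lemma D_carrier: "D \<subseteq> carrier K" and D_closed [simp]: "\<zero> \<in> D" "\<one> \<in> D"
  "\<And>x. x \<in> D \<Longrightarrow> \<ominus> x \<in> D" "\<And>x y. x \<in> D \<Longrightarrow> y \<in> D \<Longrightarrow> x \<otimes> y \<in> D"
  "\<And>x y. x \<in> D \<Longrightarrow> y \<in> D \<Longrightarrow> x \<oplus> y \<in> D"
  using subringE[OF subring_D] by auto

lemma D_in_carrier [simp]: "x \<in> D \<Longrightarrow> x \<in> carrier K"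
  using D_carrier by blast

lemma pow_closed_D [simp]: "x \<in> D \<Longrightarrow> x [^] (n::nat) \<in> D"
  by (induction n) auto

lemma nonzero_inv: "z \<in> carrier K \<Longrightarrow> z \<noteq> \<zero> \<Longrightarrow> inv z \<in> carrier K \<and> z \<otimes> inv z = \<one> \<and> inv z \<otimes> z = \<one>"
  using field_Units by auto

lemma nat_pow_subring: "x [^]\<^bsub>K\<lparr>carrier := T\<rparr>\<^esub> (n::nat) = x [^] n"
  using nat_pow_consistent by metis

lemma maximalideal_D_subset: "maximalideal P (K\<lparr>carrier := D\<rparr>) \<Longrightarrow> P \<subseteq> D"
  using domain.maximalideal_carrier[OF subring_is_domain[OF subring_D]] by auto

lemma maximalideal_zero:
  assumes "maximalideal P (K\<lparr>carrier := T\<rparr>)" shows "\<zero> \<in> P"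
  using additive_subgroup.zero_closed[OF ideal.axioms(1)[OF maximalideal.axioms(1)[OF assms]]] by simp

lemma mult_notin:
  "maximalideal P (K\<lparr>carrier := D\<rparr>) \<Longrightarrow> a \<in> D - P \<Longrightarrow> b \<in> D - P \<Longrightarrow> a \<otimes> b \<in> D - P"
  using domain.maximalideal_mult_notin[OF subring_is_domain[OF subring_D], of P a b] by auto

lemma pow_notin:
  "maximalideal P (K\<lparr>carrier := D\<rparr>) \<Longrightarrow> a \<in> D - P \<Longrightarrow> a [^] (n::nat) \<in> D - P"
  using domain.maximalideal_pow_notin[OF subring_is_domain[OF subring_D], of P a n]
  by (auto simp: nat_pow_subring)

lemma mult_in:
  assumes "maximalideal P (K\<lparr>carrier := D\<rparr>)" "a \<in> P" "d \<in> D"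
  shows "a \<otimes> d \<in> P" "d \<otimes> a \<in> P"
  using ideal.I_r_closed[OF maximalideal.axioms(1)[OF assms(1)], of a d]
    ideal.I_l_closed[OF maximalideal.axioms(1)[OF assms(1)], of a d] assms by auto

lemma add_in:
  assumes "maximalideal P (K\<lparr>carrier := D\<rparr>)" "a \<in> P" "d \<in> P"
  shows "a \<oplus> d \<in> P"
  using additive_subgroup.a_closed[OF ideal.axioms(1)[OF maximalideal.axioms(1)[OF assms(1)]], of a d] assms by auto

lemma one_notin: "maximalideal P (K\<lparr>carrier := D\<rparr>) \<Longrightarrow> \<one> \<notin> P"
  using maximalideal_one_notin by fastforce

lemma comaximal:
  assumes "maximalideal P (K\<lparr>carrier := D\<rparr>)" "s \<in> D - P"
  obtains t d where "t \<in> P" "d \<in> D" "t \<oplus> s \<otimes> d = \<one>"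
  using cring.maximalideal_comaximal[OF domain.axioms(1)[OF subring_is_domain[OF subring_D]], of P s] assms
  by auto

lemma uniformizer_iff:
  "uniformizer (K\<lparr>carrier := T\<rparr>) P p \<longleftrightarrow> p \<in> P \<and> p \<noteq> \<zero> \<and>
     (\<forall>x\<in>T - {\<zero>}. \<exists>(n::nat). \<exists>s\<in>T - P. \<exists>u\<in>T - P. s \<otimes> x = u \<otimes> p [^] n)"
  by (auto simp: uniformizer_def nat_pow_subring Bex_def)

text \<open>Membership is tested by clearing one denominator; \<open>\<zero> \<in> P\<close> keeps
  denominators nonzero, so the test can be reversed.\<close>

lemma localization_iff:
  assumes "\<zero> \<in> P"
  shows "z \<in> localization K D P \<longleftrightarrow> z \<in> carrier K \<and> (\<exists>b\<in>D - P. z \<otimes> b \<in> D)"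
proof
  assume "z \<in> localization K D P"
  then obtain a b where ab: "z = a \<otimes> inv b" "a \<in> D" "b \<in> D - P" by (auto simp: localization_def)
  then have "b \<noteq> \<zero>" using assms by auto
  then have b: "inv b \<in> carrier K" "inv b \<otimes> b = \<one>" using nonzero_inv[of b] ab by auto
  then have "z \<otimes> b = a" using ab by (simp add: m_assoc)
  then show "z \<in> carrier K \<and> (\<exists>b\<in>D - P. z \<otimes> b \<in> D)" using ab b by (metis D_in_carrier m_closed)
next
  assume "z \<in> carrier K \<and> (\<exists>b\<in>D - P. z \<otimes> b \<in> D)"
  then obtain b where z: "z \<in> carrier K" "b \<in> D - P" "z \<otimes> b \<in> D" by blast
  then have "b \<noteq> \<zero>" using assms by auto
  then have b: "inv b \<in> carrier K" "b \<otimes> inv b = \<one>" using nonzero_inv[of b] z by auto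
  then have "z = (z \<otimes> b) \<otimes> inv b" using z by (simp add: m_assoc)
  then show "z \<in> localization K D P" using z unfolding localization_def by blast
qed

lemma localizationI:
  assumes "maximalideal P (K\<lparr>carrier := D\<rparr>)" "z \<in> carrier K" "b \<in> D - P" "z \<otimes> b \<in> D"
  shows "z \<in> localization K D P"
  using assms localization_iff[OF maximalideal_zero] by blast

lemma D_subset_localization:
  assumes "maximalideal P (K\<lparr>carrier := D\<rparr>)" shows "D \<subseteq> localization K D P"
  using localizationI[OF assms, of _ \<one>] one_notin[OF assms] by auto

lemma subring_localization:
  assumes P: "maximalideal P (K\<lparr>carrier := D\<rparr>)"
  shows "subring (localization K D P) K"
proof (rule subringI)
  note iff = localization_iff[OF maximalideal_zero[OF P]]
  show "localization K D P \<subseteq> carrier K" using iff by blast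
  show "\<one> \<in> localization K D P" using D_subset_localization[OF P] by auto
  show "\<ominus> h \<in> localization K D P" if h: "h \<in> localization K D P" for h
  proof -
    obtain b where "h \<in> carrier K" "b \<in> D - P" "h \<otimes> b \<in> D" using h by (auto simp: iff)
    then show ?thesis using localizationI[OF P, of "\<ominus> h" b] by (simp add: l_minus)
  qed
  fix x y assume "x \<in> localization K D P" "y \<in> localization K D P"
  then obtain b c where b: "x \<in> carrier K" "b \<in> D - P" "x \<otimes> b \<in> D" and c: "y \<in> carrier K" "c \<in> D - P" "y \<otimes> c \<in> D"
    by (auto simp: iff)
  have bc: "b \<otimes> c \<in> D - P" by (rule mult_notin[OF P b(2) c(2)])
  have "(x \<otimes> y) \<otimes> (b \<otimes> c) = (x \<otimes> b) \<otimes> (y \<otimes> c)" using b c by (simp add: m_ac)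
  then show "x \<otimes> y \<in> localization K D P"
    using b c bc by (intro localizationI[OF P _ bc]) auto
  have "(x \<oplus> y) \<otimes> (b \<otimes> c) = (x \<otimes> b) \<otimes> c \<oplus> (y \<otimes> c) \<otimes> b" using b c by (simp add: l_distr r_distr m_ac)
  then show "x \<oplus> y \<in> localization K D P"
    using b c bc by (intro localizationI[OF P _ bc]) auto
qed

text \<open>A uniformizer \<open>p\<close> of the localization is a fraction. Its denominator
  \<open>b\<close> is a unit there, so \<open>p \<otimes> b\<close> is an equally good uniformizer
  and lies in \<open>D\<close>.\<close>

lemma uniformizer_if_discrete_valuation_ring:
  assumes P: "maximalideal P (K\<lparr>carrier := D\<rparr>)"
    and dvr: "discrete_valuation_ring (K\<lparr>carrier := localization K D P\<rparr>)"
  shows "\<exists>p. uniformizer (K\<lparr>carrier := D\<rparr>) P p"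
proof -
  let ?L = "localization K D P"
  note iff = localization_iff[OF maximalideal_zero[OF P]]
  interpret L: principal_domain "K\<lparr>carrier := ?L\<rparr>" using dvr by (simp add: discrete_valuation_ring_def)
  obtain p where p: "p \<in> ?L" "p \<noteq> \<zero>" "p \<notin> Units (K\<lparr>carrier := ?L\<rparr>)"
    and fact: "\<And>x. x \<in> ?L - {\<zero>} \<Longrightarrow> \<exists>(n::nat). \<exists>u\<in>Units (K\<lparr>carrier := ?L\<rparr>). x = u \<otimes> p [^] n"
    using L.unique_maximalideal_factorization dvr
    by (auto simp: discrete_valuation_ring_def nat_pow_subring)
  obtain b where b: "p \<in> carrier K" "b \<in> D - P" "p \<otimes> b \<in> D" using p by (auto simp: iff)
  have "p \<otimes> b \<in> P"
  proof (rule ccontr)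
    assume n: "p \<otimes> b \<notin> P"
    have i: "inv p \<in> carrier K" "inv p \<otimes> p = \<one>" using nonzero_inv[of p] b p by auto
    then have "inv p \<otimes> (p \<otimes> b) = b" using b by (simp add: m_assoc[symmetric])
    then have "inv p \<in> ?L" using localizationI[OF P, of "inv p" "p \<otimes> b"] i b n by simp
    then have "p \<in> Units (K\<lparr>carrier := ?L\<rparr>)"
      using p i nonzero_inv[of p] b by (auto simp: Units_def)
    then show False using p by blast
  qed
  moreover have "p \<otimes> b \<noteq> \<zero>" using b p maximalideal_zero[OF P] by (auto simp: integral_iff)
  moreover have "\<exists>n::nat. \<exists>s\<in>D - P. \<exists>u\<in>D - P. s \<otimes> x = u \<otimes> (p \<otimes> b) [^] n" if x: "x \<in> D - {\<zero>}" for x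
  proof -
    obtain n :: nat and u where u: "u \<in> Units (K\<lparr>carrier := ?L\<rparr>)" "x = u \<otimes> p [^] n"
      using fact[of x] x D_subset_localization[OF P] by blast
    obtain v where v: "u \<in> ?L" "v \<in> ?L" "u \<otimes> v = \<one>" using u by (auto simp: Units_def)
    obtain d e where d: "u \<in> carrier K" "d \<in> D - P" "u \<otimes> d \<in> D" and e: "v \<in> carrier K" "e \<in> D - P" "v \<otimes> e \<in> D"
      using v by (auto simp: iff)
    \<comment> \<open>The numerators of \<open>u\<close> and of its inverse \<open>v\<close>
      multiply to \<open>d \<otimes> e\<close>, which is outside \<open>P\<close>; hence so is the
      numerator of \<open>u\<close>.\<close>
    have "(u \<otimes> d) \<otimes> (v \<otimes> e) = (u \<otimes> v) \<otimes> (d \<otimes> e)" using d e by (simp add: m_ac)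
    then have "(u \<otimes> d) \<otimes> (v \<otimes> e) \<notin> P" using mult_notin[OF P d(2) e(2)] v by simp
    then have ud: "u \<otimes> d \<in> D - P" using mult_in[OF P] d e by blast
    have "(d \<otimes> b [^] n) \<otimes> x = (u \<otimes> d) \<otimes> (p [^] n \<otimes> b [^] n)" using d b u by (simp add: m_ac)
    also have "\<dots> = (u \<otimes> d) \<otimes> (p \<otimes> b) [^] n" using b by (simp add: pow_mult_distrib m_comm)
    finally show ?thesis using ud mult_notin[OF P d(2) pow_notin[OF P b(2)]] by blast
  qed
  ultimately show ?thesis unfolding uniformizer_iff by blast
qed

end

section \<open>Local divisibility in an almost Dedekind domain\<close>

locale almost_dedekind_domain = fraction_field +
  assumes uniformizer_exists: "maximalideal P (K\<lparr>carrier := D\<rparr>) \<Longrightarrow> \<exists>p. uniformizer (K\<lparr>carrier := D\<rparr>) P p"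
begin

lemma maximalideal_nonzero_element:
  assumes "maximalideal P (K\<lparr>carrier := D\<rparr>)"
  obtains a where "a \<in> P" "a \<noteq> \<zero>"
  using uniformizer_exists[OF assms] by (auto simp: uniformizer_iff)

text \<open>Comparing the exponents of \<open>x\<close> and \<open>y\<close> for one uniformizer
  decides which of them divides the other locally.\<close>

lemma local_divisibility:
  assumes P: "maximalideal P (K\<lparr>carrier := D\<rparr>)" and x: "x \<in> D" "y \<in> D"
  shows "\<exists>s\<in>D - P. \<exists>c\<in>D. s \<otimes> x = c \<otimes> y \<or> s \<otimes> y = c \<otimes> x"
proof -
  obtain p where p: "uniformizer (K\<lparr>carrier := D\<rparr>) P p" using uniformizer_exists[OF P] by blast
  have pD: "p \<in> D" using p maximalideal_D_subset[OF P] by (auto simp: uniformizer_iff)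
  have one: "\<one> \<in> D - P" using one_notin[OF P] by simp
  have le: "\<exists>s\<in>D - P. \<exists>c\<in>D. s \<otimes> x = c \<otimes> y"
    if xy: "x \<in> D" "y \<in> D" and s: "s \<in> D - P" "s \<otimes> x = u \<otimes> p [^] m" "u \<in> D"
      and t: "t \<in> D" "v \<in> D - P" "t \<otimes> y = v \<otimes> p [^] n" and nm: "n \<le> m"
    for x y s t u v and m n :: nat
  proof -
    have pm: "p [^] m = p [^] (m - n) \<otimes> p [^] n" using pD nm by (simp add: nat_pow_mult)
    have "(v \<otimes> s) \<otimes> x = v \<otimes> (u \<otimes> p [^] m)" using xy s t by (simp add: m_assoc)
    also have "\<dots> = (u \<otimes> p [^] (m - n)) \<otimes> (v \<otimes> p [^] n)" using xy s t pD by (simp add: pm m_ac)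
    also have "\<dots> = (u \<otimes> p [^] (m - n) \<otimes> t) \<otimes> y" using xy s t pD by (simp add: t(3)[symmetric] m_assoc)
    finally show ?thesis using mult_notin[OF P t(2) s(1)] s t pD
      by (intro bexI[of _ "v \<otimes> s"] bexI[of _ "u \<otimes> p [^] (m - n) \<otimes> t"]) auto
  qed
  show ?thesis
  proof (cases "x = \<zero> \<or> y = \<zero>")
    case True
    then show ?thesis using x one by (intro bexI[of _ \<one>] bexI[of _ \<zero>]) auto
  next
    case False
    obtain m :: nat and s u where s: "s \<in> D - P" "u \<in> D - P" "s \<otimes> x = u \<otimes> p [^] m"
      using p x(1) False unfolding uniformizer_iff by blast
    obtain n :: nat and t v where t: "t \<in> D - P" "v \<in> D - P" "t \<otimes> y = v \<otimes> p [^] n"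
      using p x(2) False unfolding uniformizer_iff by blast
    show ?thesis
    proof (cases "n \<le> m")
      case True
      then show ?thesis using le[OF x(1,2) s(1,3) _ _ t(2,3)] s t by blast
    next
      case False
      then show ?thesis using le[OF x(2,1) t(1,3) _ _ s(2,3)] s t by fastforce
    qed
  qed
qed

text \<open>In a valuation ring a finitely generated ideal is generated by one of its generators: a
  new element is a local multiple of the current \<open>g\<close> or replaces it. One multiplier
  \<open>s\<close> is kept for all elements because it becomes the numerator of a fraction in
  \<open>one_in_ext\<close>.\<close>

lemma local_generator:
  assumes P: "maximalideal P (K\<lparr>carrier := D\<rparr>)" and A: "finite A" "A \<subseteq> D" and a: "a \<in> D" "a \<noteq> \<zero>"
  shows "\<exists>g\<in>insert a A. g \<noteq> \<zero> \<and> (\<exists>s\<in>D - P. \<forall>b\<in>insert a A. \<exists>c\<in>D. s \<otimes> b = c \<otimes> g)"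
  using A
proof (induction A)
  case empty
  then show ?case using a one_notin[OF P] by (auto intro!: bexI[of _ \<one>])
next
  case (insert x A)
  then have "\<exists>g\<in>insert a A. g \<noteq> \<zero> \<and> (\<exists>s\<in>D - P. \<forall>b\<in>insert a A. \<exists>c\<in>D. s \<otimes> b = c \<otimes> g)"
    by blast
  then obtain g s where g: "g \<in> insert a A" "g \<noteq> \<zero>" "s \<in> D - P"
    "\<And>b. b \<in> insert a A \<Longrightarrow> \<exists>c\<in>D. s \<otimes> b = c \<otimes> g" by blast
  have gD: "g \<in> D" "x \<in> D" and iD: "insert a A \<subseteq> D" using g a insert.prems by auto
  obtain t c where t: "t \<in> D - P" "c \<in> D" "t \<otimes> x = c \<otimes> g \<or> t \<otimes> g = c \<otimes> x"
    using local_divisibility[OF P gD(2,1)] by blast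
  have st: "t \<otimes> s \<in> D - P" by (rule mult_notin[OF P t(1) g(3)])
  have tD: "s \<in> D" "t \<in> D" using t g by auto
  from t(3) show ?case
  proof
    assume eq: "t \<otimes> x = c \<otimes> g"
    have "\<exists>c\<in>D. (t \<otimes> s) \<otimes> b = c \<otimes> g" if b: "b \<in> insert a (insert x A)" for b
    proof (cases "b = x")
      case True
      have "(t \<otimes> s) \<otimes> x = s \<otimes> (t \<otimes> x)" using tD gD by (simp add: m_ac)
      also have "\<dots> = (s \<otimes> c) \<otimes> g" using tD gD t(2) by (simp add: eq m_assoc)
      finally show ?thesis using True tD t(2) by auto
    next
      case False
      then have bA: "b \<in> insert a A" using b by blast
      then obtain d where d: "d \<in> D" "s \<otimes> b = d \<otimes> g" using g(4) by blast
      have "b \<in> D" using bA iD by blast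
      then have "(t \<otimes> s) \<otimes> b = (t \<otimes> d) \<otimes> g" using tD gD d by (simp add: m_assoc)
      then show ?thesis using tD d by auto
    qed
    then show ?thesis using g st by blast
  next
    assume eq: "t \<otimes> g = c \<otimes> x"
    have "x \<noteq> \<zero>"
    proof
      assume "x = \<zero>"
      then have "t = \<zero>" using eq t(2) tD gD g(2) by (simp add: integral_iff)
      then show False using t(1) maximalideal_zero[OF P] by blast
    qed
    have "\<exists>c\<in>D. (t \<otimes> s) \<otimes> b = c \<otimes> x" if b: "b \<in> insert a (insert x A)" for b
    proof (cases "b = x")
      case True
      then show ?thesis using tD by auto
    next
      case False
      then have bA: "b \<in> insert a A" using b by blast
      then obtain d where d: "d \<in> D" "s \<otimes> b = d \<otimes> g" using g(4) by blast
      have "b \<in> D" using bA iD by blast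
      then have "(t \<otimes> s) \<otimes> b = d \<otimes> (t \<otimes> g)" using tD gD d by (simp add: m_assoc m_lcomm)
      also have "\<dots> = (d \<otimes> c) \<otimes> x" using d t(2) gD by (simp add: eq m_assoc)
      finally show ?thesis using d t(2) by auto
    qed
    then show ?thesis using st \<open>x \<noteq> \<zero>\<close> by blast
  qed
qed

section \<open>Overrings defined by families of maximal ideals\<close>

definition maxD :: "'a set set" where "maxD = {P. maximalideal P (K\<lparr>carrier := D\<rparr>)}"

definition overring :: "'a set set \<Rightarrow> 'a set" where
  "overring C = carrier K \<inter> (\<Inter>P\<in>C. localization K D P)"

definition ext_ideal :: "'a set set \<Rightarrow> 'a set \<Rightarrow> 'a set" where
  "ext_ideal C P = Idl\<^bsub>K\<lparr>carrier := overring C\<rparr>\<^esub> P"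

text \<open>One successor step of the chain, made an operation on the family alone so that ordinals
  stay out of the algebra.\<close>

definition crit_family :: "'a set set \<Rightarrow> 'a set set" where
  "crit_family C = {P \<in> maxD. ext_ideal C P \<in> Crit (K\<lparr>carrier := overring C\<rparr>)}"

text \<open>Closedness of \<open>C\<close> in the topology on the maximal ideals whose basic open sets are the
  \<open>{Q. A \<subseteq> Q}\<close> with \<open>A\<close> finite and containing a nonzero element.\<close>

definition closed_family :: "'a set set \<Rightarrow> bool" where
  "closed_family C \<longleftrightarrow> C \<subseteq> maxD \<and>
     (\<forall>P\<in>maxD - C. \<exists>A. finite A \<and> A \<subseteq> P \<and> (\<exists>a\<in>A. a \<noteq> \<zero>) \<and> (\<forall>Q\<in>C. \<not> A \<subseteq> Q))"

lemma subring_overring: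
  assumes "C \<subseteq> maxD" shows "subring (overring C) K"
proof -
  have "overring C = \<Inter>(insert (carrier K) (localization K D ` C))" by (auto simp: overring_def)
  moreover have "subring S K" if "S \<in> insert (carrier K) (localization K D ` C)" for S
    using that assms subring_localization carrier_is_subring by (auto simp: maxD_def)
  ultimately show ?thesis using subring_Inter[of "insert (carrier K) (localization K D ` C)"] by simp
qed

lemma D_subset_overring: "C \<subseteq> maxD \<Longrightarrow> D \<subseteq> overring C"
  using D_subset_localization by (auto simp: overring_def maxD_def)

text \<open>The denominators of an element \<open>z\<close> of the intersection form an ideal
  contained in no maximal ideal, so \<open>\<one>\<close> is a denominator.\<close>

lemma overring_maxD: "overring maxD = D"
proof
  show "D \<subseteq> overring maxD" by (simp add: D_subset_overring)
  interpret DR: domain "K\<lparr>carrier := D\<rparr>" by (rule subring_is_domain[OF subring_D])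
  show "overring maxD \<subseteq> D"
  proof
    fix z assume z: "z \<in> overring maxD"
    then have zK: "z \<in> carrier K" by (simp add: overring_def)
    define J where "J = {d \<in> D. z \<otimes> d \<in> D}"
    have J: "ideal J (K\<lparr>carrier := D\<rparr>)"
      by (rule DR.ideal_if_closed) (use zK in \<open>auto simp: J_def r_distr m_lcomm\<close>)
    have "J = D"
    proof (rule ccontr)
      assume "J \<noteq> D"
      then obtain P where P: "maximalideal P (K\<lparr>carrier := D\<rparr>)" "J \<subseteq> P"
        using DR.exists_maximalideal_above[OF J] by auto
      then have "z \<in> localization K D P" using z by (auto simp: overring_def maxD_def)
      then show False using P(2) by (auto simp: localization_iff[OF maximalideal_zero[OF P(1)]] J_def)
    qed
    then have "\<one> \<in> J" by simp
    then show "z \<in> D" using zK by (simp add: J_def)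
  qed
qed

context
  fixes C :: "'a set set" and T :: "'a set"
  assumes C: "C \<subseteq> maxD"
  defines "T \<equiv> overring C"
begin

lemma subring_T: "subring T K"
  unfolding T_def by (rule subring_overring[OF C])

interpretation TR: domain "K\<lparr>carrier := T\<rparr>"
  by (rule subring_is_domain[OF subring_T])

lemma T_carrier: "x \<in> T \<Longrightarrow> x \<in> carrier K"
  by (simp add: T_def overring_def)

lemma D_T: "x \<in> D \<Longrightarrow> x \<in> T"
  using D_subset_overring[OF C] by (auto simp: T_def)

lemma T_closed: "x \<in> T \<Longrightarrow> y \<in> T \<Longrightarrow> x \<otimes> y \<in> T" "x \<in> T \<Longrightarrow> y \<in> T \<Longrightarrow> x \<oplus> y \<in> T"
  using subringE(6,7)[OF subring_T] by auto

lemma maxD_T: "P \<in> maxD \<Longrightarrow> P \<subseteq> T"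
  using maximalideal_D_subset D_T by (auto simp: maxD_def)

lemma ideal_ext: "P \<in> maxD \<Longrightarrow> ideal (ext_ideal C P) (K\<lparr>carrier := T\<rparr>)"
  unfolding ext_ideal_def T_def[symmetric] using TR.genideal_ideal maxD_T by simp

lemma subset_ext: "P \<in> maxD \<Longrightarrow> P \<subseteq> ext_ideal C P"
  unfolding ext_ideal_def T_def[symmetric] using TR.genideal_self maxD_T by simp

lemma ext_carrier: "P \<in> maxD \<Longrightarrow> ext_ideal C P \<subseteq> T"
  using ideal.Icarr[OF ideal_ext] by auto

lemma ideal_T_closed:
  assumes "ideal J (K\<lparr>carrier := T\<rparr>)"
  shows "a \<in> J \<Longrightarrow> x \<in> T \<Longrightarrow> x \<otimes> a \<in> J" "a \<in> J \<Longrightarrow> x \<in> T \<Longrightarrow> a \<otimes> x \<in> J"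
    "a \<in> J \<Longrightarrow> b \<in> J \<Longrightarrow> a \<oplus> b \<in> J"
  using ideal.I_l_closed[OF assms, of a x] ideal.I_r_closed[OF assms, of a x]
    additive_subgroup.a_closed[OF ideal.axioms(1)[OF assms], of a b] by auto

text \<open>Since \<open>P \<in> C\<close>, the ring \<open>T\<close> lies in
  \<open>localization K D P\<close>. The extension of \<open>P\<close> therefore stays inside the
  trace on \<open>T\<close> of the maximal ideal of that localization; this trace is the ideal
  \<open>J\<close>.\<close>

lemma one_notin_ext:
  assumes P: "P \<in> C" shows "\<one> \<notin> ext_ideal C P"
proof -
  have Pm: "maximalideal P (K\<lparr>carrier := D\<rparr>)" "P \<in> maxD" using P C by (auto simp: maxD_def)
  have PK: "a \<in> P \<Longrightarrow> a \<in> carrier K \<and> a \<in> D" for a using maximalideal_D_subset[OF Pm(1)] by auto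
  define J where "J = {z \<in> T. \<exists>b\<in>D - P. z \<otimes> b \<in> P}"
  have J: "ideal J (K\<lparr>carrier := T\<rparr>)"
  proof (rule TR.ideal_if_closed)
    show "J \<subseteq> carrier (K\<lparr>carrier := T\<rparr>)" by (auto simp: J_def)
    have "\<zero> \<otimes> \<one> \<in> P" using maximalideal_zero[OF Pm(1)] by simp
    then have "\<exists>b\<in>D - P. \<zero> \<otimes> b \<in> P" using one_notin[OF Pm(1)] D_closed(2) by blast
    then show "\<zero>\<^bsub>K\<lparr>carrier := T\<rparr>\<^esub> \<in> J" using D_T[of \<zero>] by (simp only: J_def) simp
    fix x assume "x \<in> J"
    then obtain b where b: "x \<in> T" "b \<in> D - P" "x \<otimes> b \<in> P" by (auto simp: J_def)
    have xK: "x \<in> carrier K" using T_carrier b by blast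
    show "x \<oplus>\<^bsub>K\<lparr>carrier := T\<rparr>\<^esub> y \<in> J" if "y \<in> J" for y
    proof -
      from \<open>y \<in> J\<close> obtain c where c: "y \<in> T" "c \<in> D - P" "y \<otimes> c \<in> P" by (auto simp: J_def)
      have yK: "y \<in> carrier K" using T_carrier c by blast
      have "(x \<oplus> y) \<otimes> (b \<otimes> c) = (x \<otimes> b) \<otimes> c \<oplus> (y \<otimes> c) \<otimes> b"
        using b c xK yK by (simp add: l_distr r_distr m_ac)
      also have "\<dots> \<in> P" using add_in[OF Pm(1)] mult_in[OF Pm(1)] b c by blast
      finally show ?thesis using mult_notin[OF Pm(1) b(2) c(2)] T_closed b c by (auto simp: J_def)
    qed
    show "y \<otimes>\<^bsub>K\<lparr>carrier := T\<rparr>\<^esub> x \<in> J" if "y \<in> carrier (K\<lparr>carrier := T\<rparr>)" for y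
    proof -
      have y: "y \<in> T" "y \<in> carrier K" using that T_carrier by auto
      then have "y \<in> localization K D P" using P by (auto simp: T_def overring_def)
      then obtain c where c: "c \<in> D - P" "y \<otimes> c \<in> D"
        by (auto simp: localization_iff[OF maximalideal_zero[OF Pm(1)]])
      have "(y \<otimes> x) \<otimes> (b \<otimes> c) = (x \<otimes> b) \<otimes> (y \<otimes> c)"
        using b c xK y by (simp add: m_ac)
      also have "\<dots> \<in> P" using mult_in[OF Pm(1)] b c by blast
      finally show ?thesis using mult_notin[OF Pm(1) b(2) c(1)] T_closed b y by (auto simp: J_def)
    qed
  qed
  have "P \<subseteq> J"
  proof
    fix a assume "a \<in> P"
    then have "a \<otimes> \<one> \<in> P" "a \<in> T" using PK D_T by auto
    then show "a \<in> J" using one_notin[OF Pm(1)] unfolding J_def by (auto intro!: bexI[of _ \<one>])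
  qed
  then have "ext_ideal C P \<subseteq> J" unfolding ext_ideal_def T_def[symmetric] by (rule TR.genideal_minimal[OF J])
  moreover have "\<one> \<notin> J" by (auto simp: J_def)
  ultimately show ?thesis by blast
qed

text \<open>Modulo the extension, an element \<open>z\<close> of \<open>T\<close> agrees with the
  element \<open>(z \<otimes> b) \<otimes> d\<close> of \<open>D\<close>. If \<open>z\<close> is not
  in the extension, that element is outside \<open>P\<close> and thus comaximal with
  \<open>P\<close> in \<open>D\<close>.\<close>

lemma maximalideal_ext:
  assumes P: "P \<in> C" shows "maximalideal (ext_ideal C P) (K\<lparr>carrier := T\<rparr>)"
proof (rule maximalidealI)
  have Pm: "maximalideal P (K\<lparr>carrier := D\<rparr>)" "P \<in> maxD" using P C by (auto simp: maxD_def)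
  let ?E = "ext_ideal C P"
  show E: "ideal ?E (K\<lparr>carrier := T\<rparr>)" by (rule ideal_ext[OF Pm(2)])
  show "carrier (K\<lparr>carrier := T\<rparr>) \<noteq> ?E" using one_notin_ext[OF P] TR.one_closed by auto
  fix J assume J: "ideal J (K\<lparr>carrier := T\<rparr>)" "?E \<subseteq> J" "J \<subseteq> carrier (K\<lparr>carrier := T\<rparr>)"
  show "J = ?E \<or> J = carrier (K\<lparr>carrier := T\<rparr>)"
  proof (cases "J = ?E")
    case False
    then obtain z where z: "z \<in> J" "z \<notin> ?E" using J by blast
    have zT: "z \<in> T" "z \<in> carrier K" using z J T_carrier by auto
    then have "z \<in> localization K D P" using P by (auto simp: T_def overring_def)
    then obtain b where b: "b \<in> D - P" "z \<otimes> b \<in> D"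
      by (auto simp: localization_iff[OF maximalideal_zero[OF Pm(1)]])
    obtain t d where t: "t \<in> P" "d \<in> D" "t \<oplus> b \<otimes> d = \<one>" using comaximal[OF Pm(1) b(1)] .
    have tD: "t \<in> D" using t maximalideal_D_subset[OF Pm(1)] by blast
    have "z = z \<otimes> (t \<oplus> b \<otimes> d)" using zT t by simp
    also have "\<dots> = z \<otimes> t \<oplus> (z \<otimes> b) \<otimes> d" using zT t(2) tD b(1) by (simp add: r_distr m_assoc)
    finally have zeq: "z = z \<otimes> t \<oplus> (z \<otimes> b) \<otimes> d" .
    have ztE: "z \<otimes> t \<in> ?E" using ideal_T_closed(1)[OF E _ zT(1)] subset_ext[OF Pm(2)] t by blast
    have "(z \<otimes> b) \<otimes> d \<notin> P"
    proof
      assume "(z \<otimes> b) \<otimes> d \<in> P"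
      then have "z \<otimes> t \<oplus> (z \<otimes> b) \<otimes> d \<in> ?E" using ideal_T_closed(3)[OF E ztE] subset_ext[OF Pm(2)] by blast
      then show False using zeq z by simp
    qed
    then have "(z \<otimes> b) \<otimes> d \<in> D - P" using b t by simp
    then obtain r e where r: "r \<in> P" "e \<in> D" "r \<oplus> ((z \<otimes> b) \<otimes> d) \<otimes> e = \<one>"
      using comaximal[OF Pm(1)] by blast
    have "(z \<otimes> b) \<otimes> d = z \<otimes> (b \<otimes> d)" using zT b t by (simp add: m_assoc)
    also have "\<dots> \<in> J" using ideal_T_closed(2)[OF J(1) z(1)] D_T b t by simp
    finally have "((z \<otimes> b) \<otimes> d) \<otimes> e \<in> J" using ideal_T_closed(2)[OF J(1)] D_T r by blast
    moreover have "r \<in> J" using r subset_ext[OF Pm(2)] J by blast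
    ultimately have "\<one> \<in> J" using ideal_T_closed(3)[OF J(1)] r by metis
    then show ?thesis using ideal.one_imp_carrier[OF J(1)] by simp
  qed simp
qed

text \<open>Closedness supplies a finite \<open>A \<subseteq> P\<close> contained in no member of
  \<open>C\<close>. With \<open>g\<close> a generator of \<open>A\<close> locally at
  \<open>P\<close>, the fraction \<open>z = s / g\<close> lies in \<open>T\<close>: at
  \<open>Q \<in> C\<close>, an element of \<open>A\<close> outside \<open>Q\<close> is a
  denominator. So \<open>s = z \<otimes> g\<close> is in the extension although it is outside
  \<open>P\<close>.\<close>

lemma one_in_ext:
  assumes cl: "closed_family C" and P: "P \<in> maxD - C"
  shows "\<one> \<in> ext_ideal C P"
proof -
  have Pm: "maximalideal P (K\<lparr>carrier := D\<rparr>)" "P \<in> maxD" using P by (auto simp: maxD_def)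
  have "\<exists>A. finite A \<and> A \<subseteq> P \<and> (\<exists>a\<in>A. a \<noteq> \<zero>) \<and> (\<forall>Q\<in>C. \<not> A \<subseteq> Q)"
    using cl P by (simp add: closed_family_def)
  then obtain A a where A: "finite A" "A \<subseteq> P" "a \<in> A" "a \<noteq> \<zero>" "\<forall>Q\<in>C. \<not> A \<subseteq> Q"
    by auto
  have AD: "A \<subseteq> D" using A maximalideal_D_subset[OF Pm(1)] by blast
  have "insert a A = A" "a \<in> D" using A AD by auto
  then have "\<exists>g\<in>A. g \<noteq> \<zero> \<and> (\<exists>s\<in>D - P. \<forall>b\<in>A. \<exists>c\<in>D. s \<otimes> b = c \<otimes> g)"
    using local_generator[OF Pm(1) A(1) AD _ A(4)] by simp
  then obtain g s where g: "g \<in> A" "g \<noteq> \<zero>" "s \<in> D - P" "\<And>b. b \<in> A \<Longrightarrow> \<exists>c\<in>D. s \<otimes> b = c \<otimes> g"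
    by blast
  have gK: "g \<in> D" "g \<in> carrier K" "g \<in> P" using g AD A by auto
  have i: "inv g \<in> carrier K" "g \<otimes> inv g = \<one>" "inv g \<otimes> g = \<one>" using nonzero_inv[of g] gK g by auto
  define z where "z = s \<otimes> inv g"
  have zK: "z \<in> carrier K" using i g by (simp add: z_def)
  have zg: "z \<otimes> g = s" using i g gK by (simp add: z_def m_assoc)
  have "z \<in> localization K D Q" if Q: "Q \<in> C" for Q
  proof -
    have Qm: "maximalideal Q (K\<lparr>carrier := D\<rparr>)" using Q C by (auto simp: maxD_def)
    obtain b where b: "b \<in> A" "b \<notin> Q" using A(5) Q by blast
    obtain c where c: "c \<in> D" "s \<otimes> b = c \<otimes> g" using g(4)[OF b(1)] by blast
    have bD: "b \<in> D" using b AD by blast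
    have "z \<otimes> b = (s \<otimes> b) \<otimes> inv g" using bD g i by (simp add: z_def m_ac)
    also have "\<dots> = c" using c gK i by (simp add: m_assoc)
    finally show ?thesis using localizationI[OF Qm zK, of b] b bD c by simp
  qed
  then have "z \<in> T" using zK by (simp add: T_def overring_def)
  note E = ideal_ext[OF Pm(2)]
  have "s \<in> ext_ideal C P"
    using ideal_T_closed(1)[OF E _ \<open>z \<in> T\<close>, of g] subset_ext[OF Pm(2)] gK zg by auto
  moreover obtain t d where t: "t \<in> P" "d \<in> D" "t \<oplus> s \<otimes> d = \<one>" using comaximal[OF Pm(1) g(3)] .
  moreover have "t \<in> ext_ideal C P" using t subset_ext[OF Pm(2)] by blast
  ultimately show ?thesis using ideal_T_closed(2,3)[OF E] D_T by metis
qed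

text \<open>Take \<open>P\<close> above \<open>M \<inter> D\<close>. Factoring a nonzero element of
  \<open>M \<inter> D\<close> puts the uniformizer of \<open>P\<close>, and with it all of
  \<open>P\<close>, into the prime ideal \<open>M\<close>. By \<open>one_in_ext\<close>,
  \<open>P\<close> must belong to \<open>C\<close>.\<close>

lemma maximalideal_T_contraction:
  assumes cl: "closed_family C" and ne: "C \<noteq> {}" and M: "maximalideal M (K\<lparr>carrier := T\<rparr>)"
  shows "M \<inter> D \<in> C" "ext_ideal C (M \<inter> D) = M"
proof -
  interpret M: maximalideal M "K\<lparr>carrier := T\<rparr>" by (rule M)
  interpret M: primeideal M "K\<lparr>carrier := T\<rparr>" by (rule TR.maximalideal_prime[OF M])
  note Mi = ideal_T_closed[OF M.is_ideal]
  have M1: "\<one> \<notin> M" using maximalideal_one_notin[OF M] by simp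
  obtain Q where Q: "Q \<in> C" using ne by blast
  have Qm: "Q \<in> maxD" "maximalideal Q (K\<lparr>carrier := D\<rparr>)" using Q C by (auto simp: maxD_def)
  \<comment> \<open>A zero \<open>M\<close> would force the extension of \<open>Q\<close> to be zero
    or all of \<open>T\<close>, but it contains a nonzero \<open>q\<close> and omits
    \<open>\<one>\<close>. Nonemptiness of \<open>C\<close> enters here.\<close>
  have "\<exists>m\<in>M. m \<noteq> \<zero>"
  proof (rule ccontr)
    assume "\<not> ?thesis"
    then have "M = {\<zero>}" using maximalideal_zero[OF M] by blast
    moreover obtain q where "q \<in> Q" "q \<noteq> \<zero>" using maximalideal_nonzero_element[OF Qm(2)] .
    moreover have "ext_ideal C Q = M \<or> ext_ideal C Q = T"
      using M.I_maximal[OF ideal_ext[OF Qm(1)]] ext_carrier[OF Qm(1)] \<open>M = {\<zero>}\<close>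
        maximalideal_zero[OF maximalideal_ext[OF Q]] by auto
    ultimately show False using one_notin_ext[OF Q] D_T[of \<one>] subset_ext[OF Qm(1)] by auto
  qed
  then obtain m where m: "m \<in> M" "m \<noteq> \<zero>" by blast
  have mK: "m \<in> carrier K" using m M.Icarr T_carrier by auto
  obtain b where b: "b \<in> D" "b \<noteq> \<zero>" "m \<otimes> b \<in> D" using fractions[OF mK] by blast
  define x where "x = m \<otimes> b"
  have x: "x \<in> M" "x \<in> D" "x \<noteq> \<zero>" unfolding x_def using Mi(2)[OF m(1)] b D_T m mK by (auto simp: integral_iff)
  interpret DR: domain "K\<lparr>carrier := D\<rparr>" by (rule subring_is_domain[OF subring_D])
  have MD: "ideal (M \<inter> D) (K\<lparr>carrier := D\<rparr>)"
    by (rule DR.ideal_if_closed) (use Mi D_T maximalideal_zero[OF M] in auto)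
  have "\<one> \<in> carrier (K\<lparr>carrier := D\<rparr>)" "\<one> \<notin> M \<inter> D" using M1 by simp_all
  then have "M \<inter> D \<noteq> carrier (K\<lparr>carrier := D\<rparr>)" by metis
  then obtain P where P: "maximalideal P (K\<lparr>carrier := D\<rparr>)" "M \<inter> D \<subseteq> P"
    using DR.exists_maximalideal_above[OF MD] by blast
  obtain p where p: "uniformizer (K\<lparr>carrier := D\<rparr>) P p" using uniformizer_exists[OF P(1)] by blast
  have pP: "p \<in> P" "p \<in> D" using p maximalideal_D_subset[OF P(1)] by (auto simp: uniformizer_iff)
  have prime: "a \<in> M \<or> b \<in> M" if "a \<in> D" "b \<in> D" "a \<otimes> b \<in> M" for a b
    using M.I_prime[of a b] that D_T by auto
  have "p \<in> M"
  proof -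
    obtain n :: nat and s u where s: "s \<in> D - P" "u \<in> D - P" "s \<otimes> x = u \<otimes> p [^] n"
      using p x unfolding uniformizer_iff by blast
    have "u \<otimes> p [^] n \<in> M" using Mi(1)[OF x(1)] s D_T by (metis DiffD1)
    moreover have "u \<notin> M" using s P by blast
    ultimately have pn: "p [^] n \<in> M" using prime[of u "p [^] n"] s pP by simp
    show ?thesis
    proof (rule ccontr)
      assume "p \<notin> M"
      then have "p [^] k \<notin> M" for k :: nat by (induction k) (use M1 prime[OF _ pP(2)] pP in auto)
      then show False using pn by blast
    qed
  qed
  have "P \<subseteq> M \<inter> D"
  proof
    fix y assume y: "y \<in> P"
    then have yD: "y \<in> D" using maximalideal_D_subset[OF P(1)] by blast
    obtain s c where s: "s \<in> D - P" "c \<in> D" "s \<otimes> y = c \<otimes> p"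
      using DR.uniformizer_mem[OF P(1) p y] by auto
    then have "s \<otimes> y \<in> M" using Mi(1)[OF \<open>p \<in> M\<close>] D_T by simp
    then show "y \<in> M \<inter> D" using prime[of s y] s P(2) yD by auto
  qed
  then have PM: "M \<inter> D = P" using P(2) by blast
  have Pm: "P \<in> maxD" using P by (simp add: maxD_def)
  have EM: "ext_ideal C P \<subseteq> M"
    unfolding ext_ideal_def T_def[symmetric] using TR.genideal_minimal[OF M.is_ideal] PM by blast
  have PC: "P \<in> C" using one_in_ext[OF cl] Pm EM M1 by blast
  then show "M \<inter> D \<in> C" using PM by simp
  have "M = ext_ideal C P \<or> M = T"
    using maximalideal.I_maximal[OF maximalideal_ext[OF PC] M.is_ideal EM] M.Icarr by auto
  then show "ext_ideal C (M \<inter> D) = M" using PM M1 D_T[of \<one>] by auto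
qed

text \<open>A uniformizer of the contraction \<open>P\<close> still works at \<open>M\<close>: write
  \<open>x\<close> as a quotient of elements of \<open>D\<close> and subtract their
  exponents.\<close>

lemma uniformizer_T:
  assumes cl: "closed_family C" and ne: "C \<noteq> {}" and M: "maximalideal M (K\<lparr>carrier := T\<rparr>)"
  shows "\<exists>p. uniformizer (K\<lparr>carrier := T\<rparr>) M p"
proof -
  define P where "P = M \<inter> D"
  have P: "maximalideal P (K\<lparr>carrier := D\<rparr>)"
    using maximalideal_T_contraction[OF cl ne M] C by (auto simp: maxD_def P_def)
  interpret M: maximalideal M "K\<lparr>carrier := T\<rparr>" by (rule M)
  note Mi = ideal_T_closed[OF M.is_ideal]
  obtain p where p: "uniformizer (K\<lparr>carrier := D\<rparr>) P p" using uniformizer_exists[OF P] by blast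
  then have pM: "p \<in> M" "p \<in> D" "p \<noteq> \<zero>" by (auto simp: uniformizer_iff P_def)
  have DP: "a \<in> T - M" if "a \<in> D - P" for a using that D_T by (auto simp: P_def)
  have "\<exists>n::nat. \<exists>s\<in>T - M. \<exists>u\<in>T - M. s \<otimes> x = u \<otimes> p [^] n" if x: "x \<in> T - {\<zero>}" for x
  proof -
    have xK: "x \<in> carrier K" "x \<in> T" "x \<noteq> \<zero>" using x T_carrier by auto
    obtain b where b: "b \<in> D" "b \<noteq> \<zero>" "x \<otimes> b \<in> D" using fractions[OF xK(1)] by blast
    have "x \<otimes> b \<noteq> \<zero>" using xK b by (simp add: integral_iff)
    then obtain n :: nat and s u where s: "s \<in> D - P" "u \<in> D - P" "s \<otimes> (x \<otimes> b) = u \<otimes> p [^] n"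
      using p b unfolding uniformizer_iff by blast
    obtain m :: nat and t v where t: "t \<in> D - P" "v \<in> D - P" "t \<otimes> b = v \<otimes> p [^] m"
      using p b unfolding uniformizer_iff by blast
    have c: "s \<in> carrier K" "u \<in> carrier K" "t \<in> carrier K" "v \<in> carrier K" "b \<in> carrier K" "p \<in> carrier K"
      using s t b pM by auto
    have sv: "s \<otimes> v \<in> D - P" and tu: "t \<otimes> u \<in> D - P" using mult_notin[OF P] s t by auto
    have "(s \<otimes> v \<otimes> x) \<otimes> p [^] m = s \<otimes> x \<otimes> (v \<otimes> p [^] m)" using c xK by (simp add: m_ac)
    also have "\<dots> = t \<otimes> (s \<otimes> (x \<otimes> b))" using c xK by (simp add: t(3)[symmetric] m_ac)
    also have "\<dots> = (t \<otimes> u) \<otimes> p [^] n" using c by (simp add: s m_assoc)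
    finally have eq: "(s \<otimes> v \<otimes> x) \<otimes> p [^] m = (t \<otimes> u) \<otimes> p [^] n" .
    \<comment> \<open>Elements of \<open>T\<close> have nonnegative valuation: otherwise a multiple
      of \<open>p\<close> in \<open>T\<close> would equal \<open>t \<otimes> u\<close>, which is
      outside \<open>M\<close>.\<close>
    have "m \<le> n"
    proof (rule ccontr)
      assume "\<not> m \<le> n"
      then obtain k where k: "m = Suc k + n" using less_iff_Suc_add[of n m] by (auto simp: add_ac)
      have "p [^] m = p [^] k \<otimes> p \<otimes> p [^] n" using c nat_pow_mult[of p "Suc k" n] by (simp add: k)
      then have "(s \<otimes> v \<otimes> x \<otimes> p [^] k \<otimes> p) \<otimes> p [^] n = (t \<otimes> u) \<otimes> p [^] n"
        using eq c xK by (simp add: m_assoc)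
      then have "s \<otimes> v \<otimes> x \<otimes> p [^] k \<otimes> p = t \<otimes> u"
        using m_rcancel[OF nat_pow_nonzero[of p n]] c xK pM by simp
      moreover have "s \<otimes> v \<otimes> x \<otimes> p [^] k \<otimes> p \<in> M"
        using s t pM by (intro Mi(1) T_closed(1) xK(2)) (auto intro: D_T)
      ultimately show False using DP[OF tu] by simp
    qed
    then have "p [^] n = p [^] (n - m) \<otimes> p [^] m" using c by (simp add: nat_pow_mult)
    then have "(s \<otimes> v \<otimes> x) \<otimes> p [^] m = (t \<otimes> u \<otimes> p [^] (n - m)) \<otimes> p [^] m"
      using eq c by (simp add: m_assoc)
    then have "(s \<otimes> v) \<otimes> x = (t \<otimes> u) \<otimes> p [^] (n - m)"
      using m_rcancel[OF nat_pow_nonzero[of p m]] c xK pM by simp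
    then show ?thesis using DP[OF sv] DP[OF tu] by blast
  qed
  then show ?thesis using pM unfolding uniformizer_iff by blast
qed

text \<open>The extension of a member of \<open>C\<close> is a proper nonzero ideal. This rules out
  the field case in the definition of \<open>Crit\<close>.\<close>

lemma not_field_T:
  assumes "C \<noteq> {}" shows "\<not> field (K\<lparr>carrier := T\<rparr>)"
proof
  assume F: "field (K\<lparr>carrier := T\<rparr>)"
  obtain Q where Q: "Q \<in> C" using assms by blast
  have Qm: "Q \<in> maxD" "maximalideal Q (K\<lparr>carrier := D\<rparr>)" using Q C by (auto simp: maxD_def)
  obtain q where q: "q \<in> Q" "q \<noteq> \<zero>" using maximalideal_nonzero_element[OF Qm(2)] .
  have "ext_ideal C Q \<in> {{\<zero>}, T}" using field.all_ideals[OF F] ideal_ext[OF Qm(1)] by auto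
  then show False using q subset_ext[OF Qm(1)] one_notin_ext[OF Q] D_T[of \<one>] by auto
qed

lemma crit_family_iff:
  assumes "P \<in> C"
  shows "P \<in> crit_family C \<longleftrightarrow> \<not> (\<exists>I. finitely_generated_ideal (K\<lparr>carrier := T\<rparr>) I \<and>
    radical_ideal (K\<lparr>carrier := T\<rparr>) I \<and> I \<noteq> {\<zero>} \<and> I \<subseteq> ext_ideal C P)"
  using assms not_field_T maximalideal_ext[OF assms] C
  by (auto simp: crit_family_def T_def[symmetric] Crit_def maximal_ideals_def)

text \<open>\<open>crit_family\<close> ranges over all of \<open>maxD\<close>, but by closedness a
  point outside \<open>C\<close> extends to the unit ideal, which is not maximal.\<close>

lemma crit_family_subset:
  assumes cl: "closed_family C" shows "crit_family C \<subseteq> C"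
proof
  fix P assume "P \<in> crit_family C"
  then have P: "P \<in> maxD" "maximalideal (ext_ideal C P) (K\<lparr>carrier := T\<rparr>)"
    by (auto simp: crit_family_def T_def[symmetric] Crit_def maximal_ideals_def split: if_splits)
  then show "P \<in> C" using one_in_ext[OF cl, of P] maximalideal_one_notin[OF P(2)] by auto
qed

text \<open>The radical ideal supplied by the Baire argument in \<open>T\<close> lies in some
  maximal ideal, whose contraction is a noncritical member of \<open>C\<close>.\<close>

lemma crit_family_noteq:
  assumes cl: "closed_family C" and ne: "C \<noteq> {}" shows "crit_family C \<noteq> C"
proof
  assume eq: "crit_family C = C"
  obtain I where I: "finitely_generated_ideal (K\<lparr>carrier := T\<rparr>) I" "radical_ideal (K\<lparr>carrier := T\<rparr>) I"
    "I \<noteq> {\<zero>}" "\<one> \<notin> I"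
    using TR.exists_finitely_generated_radical_ideal[OF uniformizer_T[OF cl ne]] by auto
  have "ideal I (K\<lparr>carrier := T\<rparr>)" "I \<noteq> T" using I D_T[of \<one>] by (auto simp: radical_ideal_def)
  then obtain M where M: "maximalideal M (K\<lparr>carrier := T\<rparr>)" "I \<subseteq> M"
    using TR.exists_maximalideal_above by auto
  note con = maximalideal_T_contraction[OF cl ne M(1)]
  have "M \<inter> D \<in> crit_family C" using con(1) eq by simp
  then show False using crit_family_iff[OF con(1)] con(2) I M(2) by auto
qed

text \<open>The elements generated by finitely many members of \<open>P\<close> already form an
  ideal containing \<open>P\<close>. This turns a condition on extensions into one on finite subsets
  of \<open>P\<close>.\<close>

lemma ext_ideal_finite_support:
  assumes P: "P \<in> maxD" and z: "z \<in> ext_ideal C P"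
  shows "\<exists>A. finite A \<and> A \<subseteq> P \<and> z \<in> Idl\<^bsub>K\<lparr>carrier := T\<rparr>\<^esub> A"
proof -
  let ?I = "\<lambda>A. Idl\<^bsub>K\<lparr>carrier := T\<rparr>\<^esub> A"
  define J where "J = {z. \<exists>A. finite A \<and> A \<subseteq> P \<and> z \<in> ?I A}"
  have PT: "P \<subseteq> carrier (K\<lparr>carrier := T\<rparr>)" using maxD_T[OF P] by simp
  have id: "ideal (?I A) (K\<lparr>carrier := T\<rparr>)" if "A \<subseteq> P" for A
    using TR.genideal_ideal[of A] that PT by blast
  have mono: "?I A \<subseteq> ?I B" if "A \<subseteq> B" "B \<subseteq> P" for A B
    using TR.subset_Idl_subset[of B A] that PT by blast
  have "ideal J (K\<lparr>carrier := T\<rparr>)"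
  proof (rule TR.ideal_if_closed)
    show "J \<subseteq> carrier (K\<lparr>carrier := T\<rparr>)" using ideal.Icarr[OF id] by (auto simp: J_def)
    show "\<zero>\<^bsub>K\<lparr>carrier := T\<rparr>\<^esub> \<in> J"
      using additive_subgroup.zero_closed[OF ideal.axioms(1)[OF id[of "{}"]]]
      by (auto simp: J_def intro!: exI[of _ "{}"])
    fix a assume "a \<in> J"
    then obtain A where A: "finite A" "A \<subseteq> P" "a \<in> ?I A" by (auto simp: J_def)
    show "x \<otimes>\<^bsub>K\<lparr>carrier := T\<rparr>\<^esub> a \<in> J" if "x \<in> carrier (K\<lparr>carrier := T\<rparr>)" for x
      using ideal.I_l_closed[OF id[OF A(2)] A(3) that] A unfolding J_def by blast
    fix b assume "b \<in> J"
    then obtain B where B: "finite B" "B \<subseteq> P" "b \<in> ?I B" by (auto simp: J_def)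
    have AB: "A \<union> B \<subseteq> P" "finite (A \<union> B)" using A B by auto
    have "a \<in> ?I (A \<union> B)" "b \<in> ?I (A \<union> B)" using mono[OF _ AB(1)] A B by blast+
    then have "a \<oplus>\<^bsub>K\<lparr>carrier := T\<rparr>\<^esub> b \<in> ?I (A \<union> B)"
      using additive_subgroup.a_closed[OF ideal.axioms(1)[OF id[OF AB(1)]]] by blast
    then show "a \<oplus>\<^bsub>K\<lparr>carrier := T\<rparr>\<^esub> b \<in> J" using AB unfolding J_def by blast
  qed
  moreover have "P \<subseteq> J"
  proof
    fix a assume "a \<in> P"
    then show "a \<in> J" using TR.genideal_self[of "{a}"] PT by (auto simp: J_def intro!: exI[of _ "{a}"])
  qed
  ultimately have "ext_ideal C P \<subseteq> J"
    unfolding ext_ideal_def T_def[symmetric] by (rule TR.genideal_minimal)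
  then show ?thesis using z by (auto simp: J_def)
qed

text \<open>For a noncritical \<open>P \<in> C\<close>, the generators of a radical ideal inside its
  extension need only finitely many elements of \<open>P\<close>. Any member of \<open>C\<close>
  containing these has the same radical ideal in its extension and is noncritical too.\<close>

lemma closed_crit_family:
  assumes cl: "closed_family C" shows "closed_family (crit_family C)"
  unfolding closed_family_def
proof (intro conjI ballI)
  show "crit_family C \<subseteq> maxD" by (auto simp: crit_family_def T_def[symmetric])
  fix P assume P: "P \<in> maxD - crit_family C"
  then have Pm: "P \<in> maxD" "maximalideal P (K\<lparr>carrier := D\<rparr>)" by (auto simp: maxD_def)
  show "\<exists>A. finite A \<and> A \<subseteq> P \<and> (\<exists>a\<in>A. a \<noteq> \<zero>) \<and> (\<forall>Q\<in>crit_family C. \<not> A \<subseteq> Q)"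
  proof (cases "P \<in> C")
    case False
    then show ?thesis using cl Pm crit_family_subset[OF cl] unfolding closed_family_def
      by (meson DiffI subsetD)
  next
    case True
    then obtain I where I: "finitely_generated_ideal (K\<lparr>carrier := T\<rparr>) I" "radical_ideal (K\<lparr>carrier := T\<rparr>) I"
      "I \<noteq> {\<zero>}" "I \<subseteq> ext_ideal C P" using crit_family_iff[OF True] P by blast
    obtain B where B: "finite B" "B \<subseteq> carrier (K\<lparr>carrier := T\<rparr>)" "I = Idl\<^bsub>K\<lparr>carrier := T\<rparr>\<^esub> B"
      using I(1) by (auto simp: finitely_generated_ideal_def)
    have "B \<subseteq> ext_ideal C P" using TR.genideal_self[OF B(2)] B(3) I(4) by blast
    then have "\<forall>b\<in>B. \<exists>A. finite A \<and> A \<subseteq> P \<and> b \<in> Idl\<^bsub>K\<lparr>carrier := T\<rparr>\<^esub> A"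
      using ext_ideal_finite_support[OF Pm(1)] by blast
    then obtain F where F: "\<And>b. b \<in> B \<Longrightarrow> finite (F b) \<and> F b \<subseteq> P \<and> b \<in> Idl\<^bsub>K\<lparr>carrier := T\<rparr>\<^esub> (F b)"
      by metis
    \<comment> \<open>Closedness demands a nonzero element in the finite set, which the supports
      \<open>F b\<close> need not provide.\<close>
    obtain a where a: "a \<in> P" "a \<noteq> \<zero>" using maximalideal_nonzero_element[OF Pm(2)] .
    let ?A = "insert a (\<Union>b\<in>B. F b)"
    have "\<not> ?A \<subseteq> Q" if Q: "Q \<in> crit_family C" for Q
    proof
      assume AQ: "?A \<subseteq> Q"
      have QC: "Q \<in> C" using Q crit_family_subset[OF cl] by blast
      then have Qm: "Q \<in> maxD" using C by blast
      have "B \<subseteq> ext_ideal C Q"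
      proof
        fix b assume b: "b \<in> B"
        then have "F b \<subseteq> Q" using AQ by blast
        then have "Idl\<^bsub>K\<lparr>carrier := T\<rparr>\<^esub> (F b) \<subseteq> ext_ideal C Q"
          unfolding ext_ideal_def T_def[symmetric] using TR.subset_Idl_subset maxD_T[OF Qm] by simp
        then show "b \<in> ext_ideal C Q" using F[OF b] by blast
      qed
      then have "I \<subseteq> ext_ideal C Q" using TR.genideal_minimal[OF ideal_ext[OF Qm]] B(3) by simp
      then show False using crit_family_iff[OF QC] Q I by blast
    qed
    then show ?thesis using B(1) F a by (intro exI[of _ ?A]) auto
  qed
qed

end

section \<open>The transfinite chain\<close>

text \<open>The separate clause at index zero agrees with the general formula by
  \<open>overring_maxD\<close>, so every successor step is an instance of
  \<open>crit_family\<close>.\<close>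

lemma T_stage_eq_overring:
  assumes "Well_order r"
  shows "T_stage K D r \<alpha> = overring (Crit_stage K D r \<alpha>)"
proof (cases "underS r \<alpha> = {}")
  case True
  then show ?thesis
    using Crit_stage_zero[OF assms True, of K D] overring_maxD by (simp add: maximal_ideals_def maxD_def)
next
  case False
  then show ?thesis by (simp add: T_stage_pos overring_def)
qed

lemma Crit_stage_succ_eq:
  assumes "Well_order r" "is_succ r \<gamma> \<alpha>"
  shows "Crit_stage K D r \<alpha> = crit_family (Crit_stage K D r \<gamma>)"
  using Crit_stage_succ[OF assms, of K D] T_stage_eq_overring[OF assms(1), of \<gamma>]
  by (simp add: crit_family_def ext_ideal_def maxD_def maximal_ideals_def)

text \<open>Both claims go through one induction because \<open>crit_family_subset\<close> needs
  closedness of the preceding stage. At a limit, a point outside the intersection is separated by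
  the finite set from an earlier stage that omits it.\<close>

lemma Crit_stage_closed_antimono:
  assumes r: "Well_order r"
  shows "closed_family (Crit_stage K D r \<alpha>) \<and>
    (\<forall>\<beta>\<in>underS r \<alpha>. Crit_stage K D r \<alpha> \<subseteq> Crit_stage K D r \<beta>)"
proof -
  interpret wo_rel r using r by (simp add: wo_rel_def)
  show ?thesis
  proof (induction \<alpha> rule: well_order_induct)
    case (1 \<alpha>)
    then have IH: "closed_family (Crit_stage K D r \<beta>)"
      "\<And>\<gamma>. \<gamma> \<in> underS \<beta> \<Longrightarrow> Crit_stage K D r \<beta> \<subseteq> Crit_stage K D r \<gamma>" if "\<beta> \<in> underS \<alpha>" for \<beta>
      using that unfolding underS_def by auto
    consider (zero) "underS \<alpha> = {}" | (succ) \<gamma> where "is_succ r \<gamma> \<alpha>"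
      | (limit) "underS \<alpha> \<noteq> {}" "\<nexists>\<gamma>. is_succ r \<gamma> \<alpha>" by blast
    then show ?case
    proof cases
      case zero
      then show ?thesis using Crit_stage_zero(1)[OF r zero, of K D]
        by (simp add: closed_family_def maxD_def maximal_ideals_def)
    next
      case (succ \<gamma>)
      then have \<gamma>: "\<gamma> \<in> underS \<alpha>" "\<And>\<beta>. \<beta> \<in> underS \<alpha> \<Longrightarrow> (\<beta>, \<gamma>) \<in> r" by (auto simp: is_succ_def)
      note eq = Crit_stage_succ_eq[OF r succ]
      have sub: "Crit_stage K D r \<gamma> \<subseteq> maxD" using IH(1)[OF \<gamma>(1)] by (simp add: closed_family_def)
      have le: "Crit_stage K D r \<alpha> \<subseteq> Crit_stage K D r \<gamma>"
        using crit_family_subset[OF sub IH(1)[OF \<gamma>(1)]] eq by simp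
      have "Crit_stage K D r \<alpha> \<subseteq> Crit_stage K D r \<beta>" if "\<beta> \<in> underS \<alpha>" for \<beta>
      proof (cases "\<beta> = \<gamma>")
        case False
        then have "\<beta> \<in> underS \<gamma>" using \<gamma>(2)[OF that] by (simp add: underS_def)
        then show ?thesis using IH(2)[OF \<gamma>(1)] le by blast
      qed (use le in simp)
      then show ?thesis using closed_crit_family[OF sub IH(1)[OF \<gamma>(1)]] eq by simp
    next
      case limit
      note eq = Crit_stage_limit[OF r limit, of K D]
      have sub: "Crit_stage K D r \<alpha> \<subseteq> Crit_stage K D r \<beta>" if "\<beta> \<in> underS \<alpha>" for \<beta>
        using that eq by blast
      moreover have "closed_family (Crit_stage K D r \<alpha>)"
        unfolding closed_family_def
      proof (intro conjI ballI)
        obtain \<beta> where "\<beta> \<in> underS \<alpha>" using limit(1) by blast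
        then show "Crit_stage K D r \<alpha> \<subseteq> maxD" using sub IH(1) unfolding closed_family_def by blast
        fix P assume P: "P \<in> maxD - Crit_stage K D r \<alpha>"
        then obtain \<beta> where \<beta>: "\<beta> \<in> underS \<alpha>" "P \<notin> Crit_stage K D r \<beta>" using eq by blast
        then have "\<exists>A. finite A \<and> A \<subseteq> P \<and> (\<exists>a\<in>A. a \<noteq> \<zero>) \<and> (\<forall>Q\<in>Crit_stage K D r \<beta>. \<not> A \<subseteq> Q)"
          using IH(1)[OF \<beta>(1)] P by (simp add: closed_family_def)
        then show "\<exists>A. finite A \<and> A \<subseteq> P \<and> (\<exists>a\<in>A. a \<noteq> \<zero>) \<and> (\<forall>Q\<in>Crit_stage K D r \<alpha>. \<not> A \<subseteq> Q)"
          using sub[OF \<beta>(1)] by (meson subsetD)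
      qed
      ultimately show ?thesis by blast
    qed
  qed
qed

text \<open>A point of the stable value would let one pick, injectively, a point of each stage lost at
  the next one (the point itself at a last stage), against Cantor's theorem.\<close>

theorem Crit_infinity_empty: "Crit_infinity K D = {}"
proof (rule ccontr)
  assume "Crit_infinity K D \<noteq> {}"
  then obtain Q where Q: "Q \<in> Crit_infinity K D" by blast
  \<comment> \<open>This well-order has an index for every element of \<open>'a set set\<close>,
    more than there are possible points of type \<open>'a set\<close>.\<close>
  obtain r :: "'a set set rel" where r: "Well_order r" "Field r = UNIV"
    using well_ordering[where 'a = "'a set set"] by metis
  interpret wo_rel r using r by (simp add: wo_rel_def)
  let ?C = "Crit_stage K D r"
  have QC: "Q \<in> ?C \<alpha>" for \<alpha>
  proof -
    have "?C \<alpha> \<in> {Crit_stage K D r \<alpha> | (r :: 'a set set rel) \<alpha>. Well_order r \<and> \<alpha> \<in> Field r}"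
      using r by (auto intro!: exI[of _ r] exI[of _ \<alpha>])
    then show ?thesis using Q unfolding Crit_infinity_def by (meson InterD)
  qed
  note inv = Crit_stage_closed_antimono[OF r(1)]
  have "\<exists>P. P \<in> ?C \<alpha> \<and> (\<forall>\<beta>. \<alpha> \<in> underS \<beta> \<longrightarrow> P \<notin> ?C \<beta>)" for \<alpha>
  proof (cases "\<exists>\<beta>. \<alpha> \<in> underS \<beta>")
    case False
    then show ?thesis using QC by blast
  next
    case True
    \<comment> \<open>The least index above \<open>\<alpha>\<close> is its successor, so the step
      from \<open>\<alpha>\<close> to \<open>\<beta>\<close> is \<open>crit_family\<close>, and
      \<open>Q\<close> keeps the stage nonempty.\<close>
    define \<beta> where "\<beta> = minim {\<beta>. \<alpha> \<in> underS \<beta>}"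
    have \<beta>: "\<alpha> \<in> underS \<beta>" and least: "\<And>\<delta>. \<alpha> \<in> underS \<delta> \<Longrightarrow> (\<beta>, \<delta>) \<in> r"
      using minim_in[of "{\<beta>. \<alpha> \<in> underS \<beta>}"] minim_least[of "{\<beta>. \<alpha> \<in> underS \<beta>}"] True r(2)
      by (auto simp: \<beta>_def)
    have "is_succ r \<alpha> \<beta>"
      unfolding is_succ_def
    proof (intro conjI ballI \<beta>)
      fix \<delta> assume \<delta>: "\<delta> \<in> underS \<beta>"
      show "(\<delta>, \<alpha>) \<in> r"
      proof (rule ccontr)
        assume n: "(\<delta>, \<alpha>) \<notin> r"
        then have "\<alpha> \<in> underS \<delta>" using TOTALS r(2) unfolding underS_def by blast
        from least[OF this] \<delta> show False using ANTISYM unfolding underS_def antisym_def by blast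
      qed
    qed
    then have eq: "?C \<beta> = crit_family (?C \<alpha>)" by (rule Crit_stage_succ_eq[OF r(1)])
    have cl: "closed_family (?C \<alpha>)" "?C \<alpha> \<subseteq> maxD" using inv[of \<alpha>] by (auto simp: closed_family_def)
    have "?C \<beta> \<subset> ?C \<alpha>"
      using crit_family_noteq[OF cl(2,1)] crit_family_subset[OF cl(2,1)] eq QC[of \<alpha>] by auto
    then obtain P where P: "P \<in> ?C \<alpha>" "P \<notin> ?C \<beta>" by blast
    have "P \<notin> ?C \<delta>" if "\<alpha> \<in> underS \<delta>" for \<delta>
    proof (cases "\<beta> = \<delta>")
      case False
      then have "\<beta> \<in> underS \<delta>" using least[OF that] by (simp add: underS_def)
      then show ?thesis using inv[of \<delta>] P by blast
    qed (use P in simp)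
    then show ?thesis using P by blast
  qed
  then obtain f where f: "\<And>\<alpha>. f \<alpha> \<in> ?C \<alpha>" "\<And>\<alpha> \<beta>. \<alpha> \<in> underS \<beta> \<Longrightarrow> f \<alpha> \<notin> ?C \<beta>" by metis
  have "inj f"
  proof (rule injI, rule ccontr)
    fix \<alpha> \<beta> assume eq: "f \<alpha> = f \<beta>" and "\<alpha> \<noteq> \<beta>"
    then have "\<alpha> \<in> underS \<beta> \<or> \<beta> \<in> underS \<alpha>" using TOTALS r(2) unfolding underS_def by blast
    then show False using f eq by metis
  qed
  \<comment> \<open>Inverting \<open>f\<close> gives a map from \<open>'a set\<close> onto the sets
    of such elements, which Cantor's theorem forbids.\<close>
  then have "range (the_inv f) = UNIV" by (metis inj_imp_surj_inv surj_def the_inv_f_f)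
  then show False using Cantors_theorem[of "UNIV :: 'a set set"] by auto
qed

end

theorem theorem5p1:
  fixes K :: "('a, 'b) ring_scheme" and D :: "'a set"
  assumes "quotient_field_of K D" and "almost_dedekind K D"
  shows "SP_scattered K D"
proof -
  interpret field K using assms(1) by (simp add: quotient_field_of_def)
  interpret fraction_field K D
  proof (intro fraction_field.intro fraction_field_axioms.intro field_axioms)
    show "subring D K" using assms(1) by (simp add: quotient_field_of_def)
    then have D: "D \<subseteq> carrier K" by (rule subringE)
    fix z assume "z \<in> carrier K"
    then obtain a b where ab: "z = a \<otimes>\<^bsub>K\<^esub> inv\<^bsub>K\<^esub> b" "a \<in> D" "b \<in> D - {\<zero>\<^bsub>K\<^esub>}"
      using assms(1) unfolding quotient_field_of_def by blast
    then have "b \<in> Units K" using field_Units D by auto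
    then have "z \<otimes>\<^bsub>K\<^esub> b = a" using ab D by (simp add: m_assoc subsetD)
    then show "\<exists>b\<in>D - {\<zero>\<^bsub>K\<^esub>}. z \<otimes>\<^bsub>K\<^esub> b \<in> D" using ab by blast
  qed
  interpret almost_dedekind_domain K D
    by unfold_locales
      (use assms(2) uniformizer_if_discrete_valuation_ring in \<open>auto simp: almost_dedekind_def maximal_ideals_def\<close>)
  show ?thesis unfolding SP_scattered_def by (rule Crit_infinity_empty)
qed

end
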